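(* Let $\ell\ge 1$ and $n,m_1,\dots,m_\ell$ be positive integers, $m:=\sum_{i=1}^\ell m_i$. For $i=1,\dots,\ell$ let $C_i\subseteq\mathbb{R}^{m_i}$ be a nonempty polyhedral convex set and $A_i\in\mathbb{R}^{m_i\times n}$ a nonzero matrix, and let $\bar v\in\mathbb{R}^n$, with $\bigcap_{i=1}^\ell A_i^{-1}C_i\neq\emptyset$. Let $x^*$ be the unique solution of $\min_x\frac12\|x-\bar v\|^2$ subject to $A_ix\in C_i$, $i=1,\dots,\ell$. Let $d(\mathbf y):=\frac12\|\sum_{i=1}^\ell A_i^Ty_i-\bar v\|^2-\frac12\|\bar v\|^2+\sum_{i=1}^\ell\sigma_{C_i}(y_i)$ for $\mathbf y=(y_1,\dots,y_\ell)\in\mathbb{R}^m$, and $d^*:=\inf d$. Then $\operatorname{Argmin} d\neq\emptyset$. Moreover, let $\{x^t\},\{\mathbf y^t\}$ be generated by the following algorithm: set $\gamma_i:=\lambda_{\max}(A_i^TA_i)$, $y_i^0:=0$, $x^0:=x^0_\ell:=\bar v$; for $t=0,1,2,\dots$ set $x^{t+1}_0:=x^t_\ell$ and for $i=1,\dots,\ell$ compute $$x^{t+1}_i=(I-\gamma_i^{-1}A_i^TA_i)x^{t+1}_{i-1}+\gamma_i^{-1}A_i^T\operatorname{Proj}_{C_i}(\gamma_iy_i^t+A_ix^{t+1}_{i-1}),$$ $$y^{t+1}_i=y_i^t+\gamma_i^{-1}A_ix^{t+1}_{i-1}-\gamma_i^{-1}\operatorname{Proj}_{C_i}(\gamma_iy^t_i+A_ix^{t+1}_{i-1}),$$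 then set $x^{t+1}:=x^{t+1}_\ell$ and $\mathbf y^{t+1}:=(y^{t+1}_1,\dots,y^{t+1}_\ell)$. Then there exist $\mathbf y^*\in\operatorname{Argmin} d$, $r\in(0,1)$, $a_0\in(0,1)$, $a_1>0$ and a positive integer $\bar t$ such that for all $t\ge\bar t$, $$\|x^t-x^*\|\le a_1a_0^t,\quad d(\mathbf y^{t+1})-d^*\le r(d(\mathbf y^t)-d^* ),\quad\|\mathbf y^t-\mathbf y^*\|\le a_1a_0^t.$$
   Context: $A_i^{-1}S:=\{x:A_ix\in S\}$; $\sigma_C(y)=\sup_{u\in C}\langle y,u\rangle$ is the support function; $\operatorname{Proj}_C$ is the Euclidean projection onto $C$; $\lambda_{\max}$ is the largest eigenvalue. *)

theory Defs
  imports Complex_Main "HOL-Library.Extended_Real"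
begin

text \<open>Vectors of R^m are represented as functions nat \<Rightarrow> real vanishing at indices \<ge> m;
  a p \<times> q matrix is a function nat \<Rightarrow> nat \<Rightarrow> real whose entries with row < p, column < q matter.\<close>

definition vecs :: "nat \<Rightarrow> (nat \<Rightarrow> real) set" where
  "vecs m = {y. \<forall>k\<ge>m. y k = 0}"

definition ip :: "nat \<Rightarrow> (nat \<Rightarrow> real) \<Rightarrow> (nat \<Rightarrow> real) \<Rightarrow> real" where
  "ip m u v = (\<Sum>k<m. u k * v k)"

definition vnorm :: "nat \<Rightarrow> (nat \<Rightarrow> real) \<Rightarrow> real" where
  "vnorm m u = sqrt (ip m u u)"

definition mv :: "(nat \<Rightarrow> nat \<Rightarrow> real) \<Rightarrow> nat \<Rightarrow> nat \<Rightarrow> (nat \<Rightarrow> real) \<Rightarrow> (nat \<Rightarrow> real)" where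
  "mv A p q x = (\<lambda>j. if j < p then (\<Sum>k<q. A j k * x k) else 0)"

definition mtv :: "(nat \<Rightarrow> nat \<Rightarrow> real) \<Rightarrow> nat \<Rightarrow> nat \<Rightarrow> (nat \<Rightarrow> real) \<Rightarrow> (nat \<Rightarrow> real)" where
  "mtv A p q y = (\<lambda>k. if k < q then (\<Sum>j<p. A j k * y j) else 0)"

definition polyhedral :: "nat \<Rightarrow> (nat \<Rightarrow> real) set \<Rightarrow> bool" where
  "polyhedral m C \<longleftrightarrow> (\<exists>(p::nat) a b. C = {y \<in> vecs m. \<forall>j<p. ip m (a j) y \<le> b j})"

definition supp_fn :: "nat \<Rightarrow> (nat \<Rightarrow> real) set \<Rightarrow> (nat \<Rightarrow> real) \<Rightarrow> ereal" where
  "supp_fn m C y = (SUP u\<in>C. ereal (ip m y u))"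

definition proj :: "nat \<Rightarrow> (nat \<Rightarrow> real) set \<Rightarrow> (nat \<Rightarrow> real) \<Rightarrow> (nat \<Rightarrow> real)" where
  "proj m C z = (THE p. p \<in> C \<and> (\<forall>u\<in>C. vnorm m (z - p) \<le> vnorm m (z - u)))"

definition lambda_max :: "nat \<Rightarrow> ((nat \<Rightarrow> real) \<Rightarrow> (nat \<Rightarrow> real)) \<Rightarrow> real" where
  "lambda_max n M = Max {lam. \<exists>x\<in>vecs n. x \<noteq> (\<lambda>_. 0) \<and> M x = (\<lambda>k. lam * x k)}"

text \<open>Block vectors y = (y_1,...,y_l), y_i in R^{m_i}; components outside 1..l are ignored.\<close>
definition blocks :: "nat \<Rightarrow> (nat \<Rightarrow> nat) \<Rightarrow> (nat \<Rightarrow> nat \<Rightarrow> real) set" where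
  "blocks l m = {y. \<forall>i\<in>{1..l}. y i \<in> vecs (m i)}"

definition bnorm :: "nat \<Rightarrow> (nat \<Rightarrow> nat) \<Rightarrow> (nat \<Rightarrow> nat \<Rightarrow> real) \<Rightarrow> real" where
  "bnorm l m y = sqrt (\<Sum>i=1..l. (vnorm (m i) (y i))\<^sup>2)"

definition dual_obj :: "nat \<Rightarrow> nat \<Rightarrow> (nat \<Rightarrow> nat) \<Rightarrow> (nat \<Rightarrow> nat \<Rightarrow> nat \<Rightarrow> real)
    \<Rightarrow> (nat \<Rightarrow> (nat \<Rightarrow> real) set) \<Rightarrow> (nat \<Rightarrow> real) \<Rightarrow> (nat \<Rightarrow> nat \<Rightarrow> real) \<Rightarrow> ereal" where
  "dual_obj n l m A C v y =
     ereal ((1/2) * (vnorm n ((\<lambda>k. \<Sum>i=1..l. mtv (A i) (m i) n (y i) k) - v))\<^sup>2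
            - (1/2) * (vnorm n v)\<^sup>2)
     + (\<Sum>i=1..l. supp_fn (m i) (C i) (y i))"

definition dual_opt :: "nat \<Rightarrow> nat \<Rightarrow> (nat \<Rightarrow> nat) \<Rightarrow> (nat \<Rightarrow> nat \<Rightarrow> nat \<Rightarrow> real)
    \<Rightarrow> (nat \<Rightarrow> (nat \<Rightarrow> real) set) \<Rightarrow> (nat \<Rightarrow> real) \<Rightarrow> ereal" where
  "dual_opt n l m A C v = (INF y\<in>blocks l m. dual_obj n l m A C v y)"

definition dual_argmin :: "nat \<Rightarrow> nat \<Rightarrow> (nat \<Rightarrow> nat) \<Rightarrow> (nat \<Rightarrow> nat \<Rightarrow> nat \<Rightarrow> real)
    \<Rightarrow> (nat \<Rightarrow> (nat \<Rightarrow> real) set) \<Rightarrow> (nat \<Rightarrow> real) \<Rightarrow> (nat \<Rightarrow> nat \<Rightarrow> real) set" where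
  "dual_argmin n l m A C v =
     {y \<in> blocks l m. dual_obj n l m A C v y = dual_opt n l m A C v}"

definition feasible :: "nat \<Rightarrow> nat \<Rightarrow> (nat \<Rightarrow> nat) \<Rightarrow> (nat \<Rightarrow> nat \<Rightarrow> nat \<Rightarrow> real)
    \<Rightarrow> (nat \<Rightarrow> (nat \<Rightarrow> real) set) \<Rightarrow> (nat \<Rightarrow> real) set" where
  "feasible n l m A C = {x \<in> vecs n. \<forall>i\<in>{1..l}. mv (A i) (m i) n x \<in> C i}"

end

theory Submission
  imports Defs "HOL-Analysis.Analysis"
begin

text \<open>
  The iteration is block proximal gradient descent on the dual \<open>d\<close>, and \<open>X t l\<close> is always \<open>v - A\<^sup>T Y t\<close>.
  If \<open>x*\<close> is the projection of \<open>v\<close> onto the feasible set, then for every \<open>y\<close>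
  \<open>d y - d* = 1/2 |A\<^sup>T y - (v - x*)|\<^sup>2 + (\<Sum>i. \<sigma>\<^sub>i (y\<^sub>i) - \<langle>y\<^sub>i, A\<^sub>i x*\<rangle>)\<close>, a sum of nonnegative terms, and the dual solutions
  are the zeros of this expression. One sweep with block steps \<open>\<Delta>\<^sub>i\<close> decreases \<open>d\<close> by at least \<open>1/2 \<Sum>i. \<gamma>\<^sub>i |\<Delta>\<^sub>i|\<^sup>2\<close>,
  while convexity bounds the new gap by a constant times \<open>|\<Delta>|\<close> times the distance to the dual solutions.
  After a sweep \<open>y\<^sub>i\<close> is normal to \<open>C\<^sub>i\<close> at a projected point, so Farkas' lemma writes it as a nonnegative
  combination of active constraint normals; in terms of these multipliers the dual solutions form a
  polyhedron, and Hoffman's bound gives a distance of order \<open>sqrt (d y - d*)\<close>. Together the gap is at most a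
  constant times its own decrease, which yields the linear rate. Hoffman's bound needs
  only the case \<open>{z \<ge> 0. M z = q}\<close>: after removing kernel directions conformal to the displacement, only finitely
  many sign patterns remain, each handled by compactness.
\<close>

section \<open>Compactness in finitely many coordinates\<close>

lemma continuous_on_coordinate [continuous_intros]:
  "continuous_on S (\<lambda>x :: 'i \<Rightarrow> real. x i)"
  by (rule continuous_on_subset[OF continuous_on_product_coordinates subset_UNIV])

text \<open>Tychonoff's theorem. Vectors are functions on a possibly infinite index type, so every
  coordinate needs a bound; later uses give the bound 0 to coordinates that have to vanish.\<close>

lemma compact_box:
  fixes B :: "'i \<Rightarrow> real"
  shows "compact {x. \<forall>i. \<bar>x i\<bar> \<le> B i}"
proof -
  have "compactin (product_topology (\<lambda>_. euclidean) UNIV) (PiE UNIV (\<lambda>i. {- B i..B i}))"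
    unfolding compactin_PiE by simp
  moreover have "{x. \<forall>i. \<bar>x i\<bar> \<le> B i} = PiE UNIV (\<lambda>i. {- B i..B i})"
    by (auto simp: PiE_UNIV_domain abs_le_iff minus_le_iff)
  ultimately show ?thesis
    by (simp add: euclidean_product_topology)
qed

lemma closed_coordinates_zero: "closed {x :: 'i \<Rightarrow> real. \<forall>i\<in>Z. x i = 0}"
proof -
  have "{x :: 'i \<Rightarrow> real. \<forall>i\<in>Z. x i = 0} = (\<Inter>i\<in>Z. {x. x i = 0})" by auto
  moreover have "closed {x :: 'i \<Rightarrow> real. x i = 0}" for i
    by (intro closed_Collect_eq continuous_intros)
  ultimately show ?thesis by auto
qed

text \<open>Divide by \<open>e\<close> and let it tend to 0. This turns minimality along a segment
  into a first-order condition; \<open>e\<close> stays at most 1 because convexity guarantees no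
  more of the segment.\<close>

lemma nonneg_of_quadratic:
  fixes b c :: real
  assumes "\<And>e. 0 < e \<Longrightarrow> e \<le> 1 \<Longrightarrow> 0 \<le> e * b + e\<^sup>2 * c"
  shows "0 \<le> b"
proof (rule ccontr)
  assume "\<not> 0 \<le> b"
  \<comment> \<open>This size makes \<open>e * c\<close> at most \<open>- b / 2\<close>, so
    \<open>b + e * c\<close> keeps the sign of \<open>b\<close>.\<close>
  define e where "e = min 1 (- b / (2 * (\<bar>c\<bar> + 1)))"
  have e: "0 < e" "e \<le> 1" "e \<le> - b / (2 * (\<bar>c\<bar> + 1))"
    using \<open>\<not> 0 \<le> b\<close> by (auto simp: e_def divide_neg_pos)
  have "e * c \<le> e * (\<bar>c\<bar> + 1)" using e by (intro mult_left_mono) auto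
  also have "\<dots> \<le> - b / 2" using e(3) by (simp add: field_simps)
  finally have "b + e * c < 0" using \<open>\<not> 0 \<le> b\<close> by simp
  moreover have "0 \<le> e * (b + e * c)"
    using assms[OF e(1,2)] by (simp add: algebra_simps power2_eq_square)
  ultimately show False using e(1) by (simp add: zero_le_mult_iff)
qed

section \<open>Hoffman's bound for nonnegative systems\<close>

text \<open>The vectors conformal to \<open>s\<close> (each coordinate zero or of the sign of
  \<open>s i\<close>) form a closed cone, which by \<open>triv\<close> meets the kernel of
  \<open>M\<close> only in 0. Hence the residual \<open>F\<close> has a positive minimum on the
  compact slice \<open>U\<close>, and homogeneity extends the bound to the whole cone.\<close>

lemma conformal_bound:
  fixes M :: "'k \<Rightarrow> 'i \<Rightarrow> real" and s :: "'i \<Rightarrow> real"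
  assumes fin: "finite I" and s: "\<And>i. i \<notin> I \<Longrightarrow> s i = 0"
    and triv: "\<And>x. \<forall>i. 0 \<le> x i * s i \<and> (s i = 0 \<longrightarrow> x i = 0) \<Longrightarrow>
      \<forall>k\<in>K. (\<Sum>i\<in>I. M k i * x i) = 0 \<Longrightarrow> \<forall>i. x i = 0" and finK: "finite K"
  shows "\<exists>c\<ge>0. \<forall>x. (\<forall>i. 0 \<le> x i * s i \<and> (s i = 0 \<longrightarrow> x i = 0)) \<longrightarrow>
      (\<Sum>i\<in>I. \<bar>x i\<bar>) \<le> c * (\<Sum>k\<in>K. \<bar>\<Sum>i\<in>I. M k i * x i\<bar>)"
proof -
  define F where "F x = (\<Sum>k\<in>K. \<bar>\<Sum>i\<in>I. M k i * x i\<bar>)" for x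
  define N where "N x = (\<Sum>i\<in>I. \<bar>x i\<bar>)" for x :: "'i \<Rightarrow> real"
  define P where "P x \<longleftrightarrow> (\<forall>i. 0 \<le> x i * s i \<and> (s i = 0 \<longrightarrow> x i = 0))" for x
  define U where "U = {x. P x \<and> N x = 1}"
  have F_nonneg: "0 \<le> F x" for x unfolding F_def by (intro sum_nonneg) auto
  have "closed {x. P x}"
  proof -
    have "{x. P x} = (\<Inter>i. {x. 0 \<le> x i * s i}) \<inter> {x. \<forall>i\<in>{i. s i = 0}. x i = 0}"
      by (auto simp: P_def)
    moreover have "closed {x :: 'i \<Rightarrow> real. 0 \<le> x i * s i}" for i
      by (intro closed_Collect_le continuous_intros)
    ultimately show ?thesis
      by (simp only:) (intro closed_Int closed_INT closed_coordinates_zero ballI)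
  qed
  moreover have "closed {x. N x = 1}"
    unfolding N_def by (intro closed_Collect_eq continuous_intros)
  \<comment> \<open>Members of \<open>U\<close> already lie in this box, because \<open>s\<close>
    vanishes off \<open>I\<close>; naming the box supplies compactness.\<close>
  moreover have "U = ({x. P x} \<inter> {x. N x = 1}) \<inter> {x. \<forall>i. \<bar>x i\<bar> \<le> (if i \<in> I then 1 else 0)}"
  proof -
    have "\<bar>x i\<bar> \<le> (if i \<in> I then 1 else 0)" if "P x" "N x = 1" for x i
      using that fin s[of i] member_le_sum[of i I "\<lambda>i. \<bar>x i\<bar>"] by (auto simp: P_def N_def)
    then show ?thesis unfolding U_def by blast
  qed
  ultimately have U: "compact U"
    by (simp only:) (intro closed_Int_compact closed_Int compact_box)
  have scale: "\<exists>u\<in>U. \<forall>i. x i = N x * u i" if "P x" "N x \<noteq> 0" for x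
  proof
    have "0 \<le> N x" unfolding N_def by (intro sum_nonneg) auto
    then have N: "N x > 0" using that(2) by simp
    have "N (\<lambda>i. x i / c) = N x / c" if "c > 0" for c
      using that by (simp add: N_def sum_divide_distrib)
    from this[OF N] have "N (\<lambda>i. x i / N x) = 1" using N by simp
    then show "(\<lambda>i. x i / N x) \<in> U" using that N by (simp add: U_def P_def)
    show "\<forall>i. x i = N x * (x i / N x)" using N by simp
  qed
  have contF: "continuous_on U F" unfolding F_def by (intro continuous_intros)
  have "\<exists>c\<ge>0. \<forall>x. P x \<longrightarrow> N x \<le> c * F x"
  proof (cases "U = {}")
    case True
    \<comment> \<open>With \<open>U\<close> empty, every conformal vector has
      \<open>N x = 0\<close>, so the constant 0 serves.\<close>
    then have "\<forall>x. P x \<longrightarrow> N x \<le> 0 * F x" using scale by fastforce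
    then show ?thesis by blast
  next
    case False
    then obtain u where u: "u \<in> U" "\<And>x. x \<in> U \<Longrightarrow> F u \<le> F x"
      using continuous_attains_inf[OF U _ contF] by blast
    have "F u \<noteq> 0"
    proof
      assume "F u = 0"
      then have "\<forall>k\<in>K. (\<Sum>i\<in>I. M k i * u i) = 0"
        unfolding F_def by (subst (asm) sum_nonneg_eq_0_iff) (auto simp: finK)
      then have "\<forall>i. u i = 0" using u(1) by (intro triv) (auto simp: U_def P_def)
      with u(1) show False by (simp add: U_def N_def)
    qed
    with F_nonneg[of u] have Fu: "F u > 0" by simp
    have "N x \<le> (1 / F u) * F x" if Px: "P x" for x
    proof (cases "N x = 0")
      case True then show ?thesis using Fu F_nonneg[of x] by simp
    next
      case False
      then obtain w where w: "w \<in> U" "\<forall>i. x i = N x * w i" using scale Px by blast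
      have N: "N x \<ge> 0" unfolding N_def by (intro sum_nonneg) auto
      have "(\<Sum>i\<in>I. M k i * x i) = N x * (\<Sum>i\<in>I. M k i * w i)" for k
        by (subst w(2)[rule_format]) (simp add: sum_distrib_left mult.left_commute)
      then have "F x = N x * F w"
        unfolding F_def sum_distrib_left[where A = K] using N by (simp add: abs_mult)
      then show ?thesis using u(2)[OF w(1)] N Fu by (simp add: field_simps mult_right_mono)
    qed
    then show ?thesis using Fu by (intro exI[of _ "1 / F u"]) auto
  qed
  then show ?thesis unfolding F_def N_def P_def .
qed

text \<open>Induction on the size of the support of \<open>d\<close>. A nonzero kernel vector
  conformal to \<open>d\<close> can be subtracted until a further coordinate of \<open>d\<close>
  vanishes, without changing the image under \<open>M\<close>. The shrinking is recorded by factors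
  in [0,1], so that moving by the reduced displacement never overshoots.\<close>

lemma conformal_reduction:
  fixes M :: "'k \<Rightarrow> 'i \<Rightarrow> real" and d :: "'i \<Rightarrow> real"
  assumes fin: "finite I" and "\<And>i. i \<notin> I \<Longrightarrow> d i = 0"
  shows "\<exists>\<theta>. (\<forall>i. 0 \<le> \<theta> i \<and> \<theta> i \<le> 1) \<and>
    (\<forall>k\<in>K. (\<Sum>i\<in>I. M k i * (\<theta> i * d i)) = (\<Sum>i\<in>I. M k i * d i)) \<and>
    (\<forall>x. (\<forall>i. 0 \<le> x i * (\<theta> i * d i) \<and> (\<theta> i * d i = 0 \<longrightarrow> x i = 0)) \<longrightarrow>
       (\<forall>k\<in>K. (\<Sum>i\<in>I. M k i * x i) = 0) \<longrightarrow> (\<forall>i. x i = 0))"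
  using assms(2)
proof (induction "card {i. d i \<noteq> 0}" arbitrary: d rule: less_induct)
  case less
  have supp: "finite {i. d i \<noteq> 0}"
    using less.prems by (intro finite_subset[OF _ fin]) blast
  show ?case
  proof (cases "\<forall>x. (\<forall>i. 0 \<le> x i * d i \<and> (d i = 0 \<longrightarrow> x i = 0)) \<longrightarrow>
       (\<forall>k\<in>K. (\<Sum>i\<in>I. M k i * x i) = 0) \<longrightarrow> (\<forall>i. x i = 0)")
    case True
    then show ?thesis by (intro exI[of _ "\<lambda>_. 1"]) simp
  next
    case False
    then obtain x i0 where x: "\<And>i. 0 \<le> x i * d i" "\<And>i. d i = 0 \<Longrightarrow> x i = 0"
      "\<forall>k\<in>K. (\<Sum>i\<in>I. M k i * x i) = 0" "x i0 \<noteq> 0" by blast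
    define T where "T = {i. x i \<noteq> 0}"
    have T: "finite T" "i0 \<in> T" "T \<subseteq> {i. d i \<noteq> 0}"
      using x supp by (auto simp: T_def intro: finite_subset[OF _ supp])
    \<comment> \<open>The largest multiple of \<open>x\<close> that can be subtracted from
      \<open>d\<close> without a sign change; the coordinate attaining the minimum becomes
      0.\<close>
    define e where "e = Min ((\<lambda>i. d i / x i) ` T)"
    have ratio: "0 < d i / x i" if "i \<in> T" for i
      using that x(1)[of i] x(2)[of i] by (force simp: T_def zero_less_divide_iff zero_le_mult_iff)
    have e_le: "e \<le> d i / x i" if "i \<in> T" for i using that T(1) by (simp add: e_def)
    have "e \<in> (\<lambda>i. d i / x i) ` T" using T unfolding e_def by (intro Min_in) auto
    then obtain i1 where i1: "i1 \<in> T" "e = d i1 / x i1" by blast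
    have e: "e > 0" using i1 ratio by simp
    \<comment> \<open>Where \<open>d i = 0\<close>, division by zero gives \<open>f i = 1\<close>,
      and \<open>fd\<close> below still holds because \<open>x i = 0\<close> there.\<close>
    define f where "f i = 1 - e * x i / d i" for i
    have f: "0 \<le> f i" "f i \<le> 1" for i
    proof -
      have "0 \<le> x i / d i" using x(1)[of i] by (auto simp: zero_le_divide_iff zero_le_mult_iff)
      then have "0 \<le> e * (x i / d i)" using e by (intro mult_nonneg_nonneg) auto
      then show "f i \<le> 1" unfolding f_def by simp
      show "0 \<le> f i"
      proof (cases "i \<in> T")
        case True
        have "e * (x i / d i) \<le> (d i / x i) * (x i / d i)"
          using e_le[OF True] ratio[OF True]
          by (intro mult_right_mono) (auto simp: zero_le_divide_iff zero_less_divide_iff)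
        then show ?thesis using True T(3) by (auto simp: f_def T_def)
      qed (simp add: f_def T_def)
    qed
    have fd: "f i * d i = d i - e * x i" for i using x(2)[of i] by (auto simp: f_def field_simps)
    have "{i. f i * d i \<noteq> 0} \<subset> {i. d i \<noteq> 0}"
    proof -
      have "f i1 * d i1 = 0" using i1 by (auto simp: fd T_def)
      then show ?thesis using i1(1) T(3) by auto
    qed
    then have "card {i. f i * d i \<noteq> 0} < card {i. d i \<noteq> 0}"
      by (rule psubset_card_mono[OF supp])
    moreover have "f i * d i = 0" if "i \<notin> I" for i using less.prems that by simp
    ultimately obtain \<theta> where \<theta>: "\<forall>i. 0 \<le> \<theta> i \<and> \<theta> i \<le> 1"
      "\<forall>k\<in>K. (\<Sum>i\<in>I. M k i * (\<theta> i * (f i * d i))) = (\<Sum>i\<in>I. M k i * (f i * d i))"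
      "\<forall>x. (\<forall>i. 0 \<le> x i * (\<theta> i * (f i * d i)) \<and> (\<theta> i * (f i * d i) = 0 \<longrightarrow> x i = 0)) \<longrightarrow>
       (\<forall>k\<in>K. (\<Sum>i\<in>I. M k i * x i) = 0) \<longrightarrow> (\<forall>i. x i = 0)"
      using less.hyps[of "\<lambda>i. f i * d i"] by auto
    have "(\<Sum>i\<in>I. M k i * (f i * d i)) = (\<Sum>i\<in>I. M k i * d i)" if "k \<in> K" for k
    proof -
      have "(\<Sum>i\<in>I. M k i * (f i * d i)) = (\<Sum>i\<in>I. M k i * d i) - e * (\<Sum>i\<in>I. M k i * x i)"
        by (simp add: fd right_diff_distrib sum_subtractf sum_distrib_left mult.left_commute)
      then show ?thesis using x(3) that by simp
    qed
    then have "\<forall>k\<in>K. (\<Sum>i\<in>I. M k i * (\<theta> i * (f i * d i))) = (\<Sum>i\<in>I. M k i * d i)"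
      using \<theta>(2) by (metis (no_types, lifting))
    moreover have "\<forall>i. 0 \<le> \<theta> i * f i \<and> \<theta> i * f i \<le> 1"
      using \<theta>(1) f by (simp add: mult_le_one)
    ultimately show ?thesis
      using \<theta>(3) by (intro exI[of _ "\<lambda>i. \<theta> i * f i"]) (simp only: mult.assoc simp_thms)
  qed
qed

text \<open>Solvability is encoded by a nonnegative \<open>z\<close> having the required image. The
  displacement from \<open>x\<close> to \<open>z\<close> is first reduced by
  \<open>conformal_reduction\<close>, after which \<open>conformal_bound\<close> applies to its sign
  pattern. There are finitely many patterns, so one constant serves all \<open>x\<close> and
  \<open>z\<close>.\<close>

theorem hoffman_nonneg:
  fixes M :: "'k \<Rightarrow> 'i \<Rightarrow> real"
  assumes fin: "finite I" "finite K"
  shows "\<exists>H\<ge>0. \<forall>x z. (\<forall>i\<in>I. 0 \<le> x i) \<longrightarrow> (\<forall>i\<in>I. 0 \<le> z i) \<longrightarrow>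
    (\<exists>w. (\<forall>i\<in>I. 0 \<le> w i) \<and> (\<forall>k\<in>K. (\<Sum>i\<in>I. M k i * w i) = (\<Sum>i\<in>I. M k i * z i)) \<and>
      (\<Sum>i\<in>I. \<bar>w i - x i\<bar>) \<le> H * (\<Sum>k\<in>K. \<bar>(\<Sum>i\<in>I. M k i * x i) - (\<Sum>i\<in>I. M k i * z i)\<bar>))"
proof -
  define S :: "('i \<Rightarrow> real) set" where "S = {s. \<forall>i. (i \<in> I \<longrightarrow> s i \<in> {-1, 0, 1}) \<and> (i \<notin> I \<longrightarrow> s i = 0)}"
  have finS: "finite S" unfolding S_def by (rule finite_set_of_finite_funs) (auto simp: fin)
  define good where "good s c \<longleftrightarrow> c \<ge> 0 \<and> (\<forall>x. (\<forall>i. 0 \<le> x i * s i \<and> (s i = 0 \<longrightarrow> x i = 0)) \<longrightarrow>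
      (\<Sum>i\<in>I. \<bar>x i\<bar>) \<le> c * (\<Sum>k\<in>K. \<bar>\<Sum>i\<in>I. M k i * x i\<bar>))" for s :: "'i \<Rightarrow> real" and c
  \<comment> \<open>Patterns without a good constant get 0, so that the sum \<open>H\<close> over
    all patterns is nonnegative and dominates each \<open>c s\<close>.\<close>
  define c where "c s = (if \<exists>c. good s c then SOME c. good s c else 0)" for s
  have c: "good s (c s)" if "good s c'" for s c'
    using that by (auto simp: c_def intro: someI)
  have c_nonneg: "0 \<le> c s" for s
    using c[of s] by (cases "\<exists>c. good s c") (auto simp: good_def c_def)
  define H where "H = (\<Sum>s\<in>S. c s)"
  have H: "H \<ge> 0" unfolding H_def by (intro sum_nonneg) (simp add: c_nonneg)
  have "\<exists>w. (\<forall>i\<in>I. 0 \<le> w i) \<and> (\<forall>k\<in>K. (\<Sum>i\<in>I. M k i * w i) = (\<Sum>i\<in>I. M k i * z i)) \<and>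
      (\<Sum>i\<in>I. \<bar>w i - x i\<bar>) \<le> H * (\<Sum>k\<in>K. \<bar>(\<Sum>i\<in>I. M k i * x i) - (\<Sum>i\<in>I. M k i * z i)\<bar>)"
    if x: "\<forall>i\<in>I. 0 \<le> x i" and z: "\<forall>i\<in>I. 0 \<le> z i" for x z
  proof -
    define d where "d i = (if i \<in> I then z i - x i else 0)" for i
    obtain \<theta> where \<theta>: "\<forall>i. 0 \<le> \<theta> i \<and> \<theta> i \<le> 1"
      "\<forall>k\<in>K. (\<Sum>i\<in>I. M k i * (\<theta> i * d i)) = (\<Sum>i\<in>I. M k i * d i)"
      "\<forall>x. (\<forall>i. 0 \<le> x i * (\<theta> i * d i) \<and> (\<theta> i * d i = 0 \<longrightarrow> x i = 0)) \<longrightarrow>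
       (\<forall>k\<in>K. (\<Sum>i\<in>I. M k i * x i) = 0) \<longrightarrow> (\<forall>i. x i = 0)"
      using conformal_reduction[of I d K M] fin by (auto simp: d_def)
    define s where "s i = sgn (\<theta> i * d i)" for i
    have "s \<in> S" by (auto simp: S_def s_def d_def sgn_if)
    \<comment> \<open>The pattern \<open>s\<close> remembers only signs, and conformity depends on
      nothing else.\<close>
    have conf: "0 \<le> y i * s i \<and> (s i = 0 \<longrightarrow> y i = 0) \<longleftrightarrow>
        0 \<le> y i * (\<theta> i * d i) \<and> (\<theta> i * d i = 0 \<longrightarrow> y i = 0)" for y i
      unfolding s_def by (cases "\<theta> i * d i" "0 :: real" rule: linorder_cases)
        (auto simp: zero_le_mult_iff[of "y i"])
    have "\<exists>c. good s c"
      unfolding good_def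
    proof (rule conformal_bound)
      show "s i = 0" if "i \<notin> I" for i using that by (simp add: s_def d_def)
      show "\<forall>i. y i = 0" if "\<forall>i. 0 \<le> y i * s i \<and> (s i = 0 \<longrightarrow> y i = 0)"
        "\<forall>k\<in>K. (\<Sum>i\<in>I. M k i * y i) = 0" for y
        using that \<theta>(3) unfolding conf by blast
    qed (use fin in auto)
    then have "good s (c s)" using c by blast
    then have "(\<Sum>i\<in>I. \<bar>\<theta> i * d i\<bar>) \<le> c s * (\<Sum>k\<in>K. \<bar>\<Sum>i\<in>I. M k i * (\<theta> i * d i)\<bar>)"
      unfolding good_def using conf by simp
    also have "\<dots> \<le> H * (\<Sum>k\<in>K. \<bar>\<Sum>i\<in>I. M k i * (\<theta> i * d i)\<bar>)"
    proof (intro mult_right_mono)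
      show "c s \<le> H" unfolding H_def using finS \<open>s \<in> S\<close> c_nonneg by (intro member_le_sum) auto
    qed (intro sum_nonneg; simp)
    finally have bound: "(\<Sum>i\<in>I. \<bar>\<theta> i * d i\<bar>) \<le> H * (\<Sum>k\<in>K. \<bar>\<Sum>i\<in>I. M k i * d i\<bar>)"
      using \<theta>(2) by simp
    have Md: "(\<Sum>i\<in>I. M k i * d i) = (\<Sum>i\<in>I. M k i * z i) - (\<Sum>i\<in>I. M k i * x i)" for k
      by (simp add: d_def right_diff_distrib sum_subtractf)
    have "0 \<le> x i + \<theta> i * d i" if "i \<in> I" for i
    proof -
      have "x i + \<theta> i * d i = (1 - \<theta> i) * x i + \<theta> i * z i"
        using that by (simp add: d_def algebra_simps)
      then show ?thesis using that x z \<theta>(1) by simp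
    qed
    moreover have "(\<Sum>i\<in>I. M k i * (x i + \<theta> i * d i)) = (\<Sum>i\<in>I. M k i * z i)" if "k \<in> K" for k
      using \<theta>(2) that Md[of k] by (simp add: distrib_left sum.distrib)
    moreover have "(\<Sum>i\<in>I. \<bar>x i + \<theta> i * d i - x i\<bar>)
        \<le> H * (\<Sum>k\<in>K. \<bar>(\<Sum>i\<in>I. M k i * x i) - (\<Sum>i\<in>I. M k i * z i)\<bar>)"
      using bound by (simp add: Md abs_minus_commute)
    ultimately show ?thesis by (intro exI[of _ "\<lambda>i. x i + \<theta> i * d i"]) auto
  qed
  then show ?thesis using H by blast
qed

section \<open>Inner products and Farkas' lemma\<close>

lemma ip_commute: "ip m u w = ip m w u"
  by (simp add: ip_def mult.commute)

lemma ip_add_left: "ip m (\<lambda>k. u k + w k) z = ip m u z + ip m w z"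
  by (simp add: ip_def distrib_right sum.distrib)

lemma ip_diff_left: "ip m (u - w) z = ip m u z - ip m w z"
  by (simp add: ip_def left_diff_distrib sum_subtractf)

lemma ip_diff_right: "ip m z (u - w) = ip m z u - ip m z w"
  by (simp add: ip_def right_diff_distrib sum_subtractf)

lemma ip_scale_left: "ip m (\<lambda>k. c * u k) z = c * ip m u z"
  by (simp add: ip_def sum_distrib_left mult.assoc)

lemma ip_scale_right: "ip m z (\<lambda>k. c * u k) = c * ip m z u"
  by (simp add: ip_def sum_distrib_left mult.left_commute)

lemma ip_add_right: "ip m z (\<lambda>k. u k + w k) = ip m z u + ip m z w"
  by (simp add: ip_def distrib_left sum.distrib)

lemma ip_sum_left: "ip m (\<lambda>k. \<Sum>j\<in>J. c j * a j k) z = (\<Sum>j\<in>J. c j * ip m (a j) z)"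
  unfolding ip_def sum_distrib_left sum_distrib_right
  by (subst sum.swap) (simp add: mult.assoc)

lemma ip_cong: "(\<And>k. k < m \<Longrightarrow> u k = u' k) \<Longrightarrow> (\<And>k. k < m \<Longrightarrow> w k = w' k) \<Longrightarrow> ip m u w = ip m u' w'"
  by (simp add: ip_def)

lemma ip_self_nonneg [simp]: "0 \<le> ip m u u"
  by (simp add: ip_def sum_nonneg)

lemma ip_self_nonpos: "ip m u u \<le> 0 \<Longrightarrow> k < m \<Longrightarrow> u k = 0"
  using sum_nonneg_eq_0_iff[of "{..<m}" "\<lambda>k. u k * u k"] ip_self_nonneg[of m u]
  by (auto simp: ip_def)

lemma ip_expand: "ip m (\<lambda>k. u k + e * w k) (\<lambda>k. u k + e * w k) = ip m u u + e * (2 * ip m u w) + e\<^sup>2 * ip m w w"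
  by (simp add: ip_add_left ip_add_right ip_scale_left ip_scale_right ip_commute[of m w u]
      power2_eq_square algebra_simps)

lemma vnorm_L2_set: "vnorm m u = L2_set u {..<m}"
  by (simp add: vnorm_def ip_def L2_set_def power2_eq_square)

lemma vnorm_nonneg [simp]: "0 \<le> vnorm m u"
  by (simp add: vnorm_def)

lemma vnorm_sq: "(vnorm m u)\<^sup>2 = ip m u u"
  by (simp add: vnorm_def)

lemma vnorm_le_iff: "vnorm m u \<le> vnorm m w \<longleftrightarrow> ip m u u \<le> ip m w w"
  by (simp add: vnorm_def)

lemma ip_le_vnorm: "\<bar>ip m u w\<bar> \<le> vnorm m u * vnorm m w"
proof -
  have "\<bar>ip m u w\<bar> \<le> (\<Sum>k<m. \<bar>u k\<bar> * \<bar>w k\<bar>)"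
    unfolding ip_def using sum_abs[of "\<lambda>k. u k * w k" "{..<m}"] by (simp add: abs_mult)
  then show ?thesis using L2_set_mult_ineq[of u w "{..<m}"] by (simp add: vnorm_L2_set)
qed

lemma coordinate_le_vnorm: "k < m \<Longrightarrow> \<bar>u k\<bar> \<le> vnorm m u"
  using member_le_L2_set[of "{..<m}" k "\<lambda>k. \<bar>u k\<bar>"] by (simp add: vnorm_L2_set L2_set_def)

lemma vnorm_le_sum_abs: "vnorm m u \<le> (\<Sum>k<m. \<bar>u k\<bar>)"
  unfolding vnorm_L2_set by (rule L2_set_le_sum_abs)

lemma vnorm_diff_commute: "vnorm m (u - w) = vnorm m (w - u)"
  by (simp add: vnorm_def ip_def power2_commute flip: power2_eq_square)

lemma vnorm_add_le: "vnorm m (\<lambda>k. u k + w k) \<le> vnorm m u + vnorm m w"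
  unfolding vnorm_L2_set by (rule L2_set_triangle_ineq)

lemma vnorm_scale: "vnorm m (\<lambda>k. c * u k) = \<bar>c\<bar> * vnorm m u"
  by (simp add: vnorm_def ip_scale_left ip_scale_right real_sqrt_mult flip: mult.assoc)

lemma vnorm_cong: "(\<And>k. k < m \<Longrightarrow> u k = w k) \<Longrightarrow> vnorm m u = vnorm m w"
  by (simp add: vnorm_def ip_def)

section \<open>Matrices and their transposes as adjoint linear maps\<close>

lemma mv_in_vecs: "mv A p q x \<in> vecs p"
  by (simp add: mv_def vecs_def)

lemma mtv_in_vecs: "mtv A p q y \<in> vecs q"
  by (simp add: mtv_def vecs_def)

lemma mv_adjoint: "ip p (mv A p q x) y = ip q x (mtv A p q y)"
proof -
  have "ip p (mv A p q x) y = (\<Sum>j<p. \<Sum>k<q. A j k * x k * y j)"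
    by (simp add: ip_def mv_def sum_distrib_right)
  also have "\<dots> = (\<Sum>k<q. \<Sum>j<p. A j k * x k * y j)" by (rule sum.swap)
  also have "\<dots> = ip q x (mtv A p q y)"
    by (simp add: ip_def mtv_def sum_distrib_left mult_ac)
  finally show ?thesis .
qed

lemma mtv_adjoint: "ip q (mtv A p q y) x = ip p y (mv A p q x)"
  using mv_adjoint[of p A q x y] by (simp add: ip_commute)

lemma mv_diff: "mv A p q (x - x') = mv A p q x - mv A p q x'"
  by (auto simp: mv_def right_diff_distrib sum_subtractf)

lemma mtv_diff: "mtv A p q (x - x') = mtv A p q x - mtv A p q x'"
  by (auto simp: mtv_def right_diff_distrib sum_subtractf)

lemma mv_add_scale: "mv A p q (\<lambda>k. x k + e * d k) = (\<lambda>j. mv A p q x j + e * mv A p q d j)"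
  by (auto simp: mv_def distrib_left sum.distrib sum_distrib_left mult.left_commute)

lemma mtv_scale: "mtv A p q (\<lambda>k. e * d k) = (\<lambda>j. e * mtv A p q d j)"
  by (auto simp: mtv_def sum_distrib_left mult.left_commute)

lemma mtv_cong: "(\<And>j. j < p \<Longrightarrow> y j = y' j) \<Longrightarrow> mtv A p q y = mtv A p q y'"
  by (auto simp: mtv_def)

lemma mtv_sum: "mtv A p q (\<lambda>k. \<Sum>j\<in>J. c j * a j k) i = (\<Sum>j\<in>J. c j * mtv A p q (a j) i)"
  unfolding mtv_def by (auto simp: sum_distrib_left sum.swap[of _ J] mult.left_commute)

text \<open>Projects \<open>y\<close> onto the cone generated by the \<open>a j\<close>. Hoffman's
  bound stands in for closedness of the cone: coefficients may be taken from a compact set, so a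
  best approximation exists. Its optimality conditions make the residual \<open>h\<close> a test
  direction for \<open>imp\<close>, which forces \<open>h\<close> to vanish below
  \<open>m\<close>.\<close>

theorem farkas:
  fixes a :: "'j \<Rightarrow> nat \<Rightarrow> real"
  assumes fin: "finite J" and imp: "\<And>h. \<forall>j\<in>J. ip m (a j) h \<le> 0 \<Longrightarrow> ip m y h \<le> 0"
  shows "\<exists>c. (\<forall>j\<in>J. 0 \<le> c j) \<and> (\<forall>k<m. y k = (\<Sum>j\<in>J. c j * a j k))"
proof -
  define L where "L c k = (\<Sum>j\<in>J. a j k * c j)" for c k
  define F where "F c = (\<Sum>k<m. (y k - L c k)\<^sup>2)" for c
  obtain H where H: "H \<ge> 0" "\<And>x z. \<forall>j\<in>J. 0 \<le> x j \<Longrightarrow> \<forall>j\<in>J. 0 \<le> z j \<Longrightarrow>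
    \<exists>w. (\<forall>j\<in>J. 0 \<le> w j) \<and> (\<forall>k\<in>{..<m}. L w k = L z k) \<and>
      (\<Sum>j\<in>J. \<bar>w j - x j\<bar>) \<le> H * (\<Sum>k<m. \<bar>L x k - L z k\<bar>)"
    using hoffman_nonneg[of J "{..<m}" "\<lambda>k j. a j k"] fin unfolding L_def by auto
  \<comment> \<open>Bounds the coefficients that Hoffman's bound, started from 0, yields for any
    cone element no farther from \<open>y\<close> than 0 is.\<close>
  define R where "R = H * (\<Sum>k<m. \<bar>y k\<bar> + sqrt (F (\<lambda>_. 0)))"
  have R: "R \<ge> 0" unfolding R_def F_def using H(1)
    by (intro mult_nonneg_nonneg sum_nonneg add_nonneg_nonneg real_sqrt_ge_zero) auto
  define U where "U = {c. (\<forall>j. \<bar>c j\<bar> \<le> (if j \<in> J then R else 0))} \<inter> (\<Inter>j. {c :: 'j \<Rightarrow> real. 0 \<le> c j})"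
  have "closed {c :: 'j \<Rightarrow> real. 0 \<le> c j}" for j
    by (intro closed_Collect_le continuous_intros)
  then have "compact U" unfolding U_def by (intro compact_Int_closed compact_box closed_INT) auto
  moreover have U0: "(\<lambda>_. 0) \<in> U" using R by (simp add: U_def)
  moreover have "continuous_on U F" unfolding F_def L_def by (intro continuous_intros)
  ultimately obtain c where c: "c \<in> U" "\<And>w. w \<in> U \<Longrightarrow> F c \<le> F w"
    using continuous_attains_inf[of U F] by blast
  have c0: "\<forall>j. 0 \<le> c j" using c(1) by (auto simp: U_def)
  \<comment> \<open>Minimality over \<open>U\<close> extends to all nonnegative coefficients:
    \<open>z\<close> is either worse than 0 or has the same image as a member of
    \<open>U\<close>.\<close>
  have min: "F c \<le> F z" if z: "\<forall>j\<in>J. 0 \<le> z j" for z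
  proof (cases "F z \<le> F (\<lambda>_. 0)")
    case False
    then show ?thesis using c(2)[OF U0] by simp
  next
    case True
    obtain w where w: "\<forall>j\<in>J. 0 \<le> w j" "\<forall>k\<in>{..<m}. L w k = L z k"
      "(\<Sum>j\<in>J. \<bar>w j\<bar>) \<le> H * (\<Sum>k<m. \<bar>L z k\<bar>)"
      using H(2)[of "\<lambda>_. 0" z] z by (auto simp: L_def)
    have "\<bar>L z k\<bar> \<le> \<bar>y k\<bar> + sqrt (F (\<lambda>_. 0))" if "k < m" for k
    proof -
      have "(y k - L z k)\<^sup>2 \<le> F z"
        unfolding F_def using that by (intro member_le_sum[of k]) auto
      then have "\<bar>y k - L z k\<bar> \<le> sqrt (F (\<lambda>_. 0))"
        using True by (intro real_le_rsqrt) simp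
      then show ?thesis by linarith
    qed
    then have "(\<Sum>k<m. \<bar>L z k\<bar>) \<le> (\<Sum>k<m. \<bar>y k\<bar> + sqrt (F (\<lambda>_. 0)))"
      by (intro sum_mono) simp
    then have wR: "(\<Sum>j\<in>J. \<bar>w j\<bar>) \<le> R"
      using w(3) mult_left_mono[OF _ H(1)] unfolding R_def by (meson order_trans)
    define w' where "w' j = (if j \<in> J then w j else 0)" for j
    have "\<bar>w j\<bar> \<le> R" if "j \<in> J" for j
      using member_le_sum[of j J "\<lambda>j. \<bar>w j\<bar>"] fin that wR by simp
    then have "w' \<in> U" using w(1) by (auto simp: U_def w'_def)
    then have "F c \<le> F w'" by (rule c(2))
    also have "F w' = F z" using w(2) unfolding F_def by (simp add: L_def w'_def)
    finally show ?thesis .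
  qed
  define h where "h k = y k - L c k" for k
  have Fh: "F c = ip m h h" by (simp add: F_def ip_def h_def power2_eq_square)
  have dir: "ip m (L d) h \<le> 0" if d: "\<And>e. 0 < e \<Longrightarrow> e \<le> 1 \<Longrightarrow> \<forall>j\<in>J. 0 \<le> c j + e * d j" for d
  proof -
    have "0 \<le> e * (- 2 * ip m h (L d)) + e\<^sup>2 * ip m (L d) (L d)" if "0 < e" "e \<le> 1" for e :: real
    proof -
      have "y k - L (\<lambda>j. c j + e * d j) k = h k + (- e) * L d k" for k
        by (simp add: h_def L_def distrib_left sum.distrib sum_distrib_left sum_negf mult.left_commute)
      then have "F (\<lambda>j. c j + e * d j) = ip m (\<lambda>k. h k + (- e) * L d k) (\<lambda>k. h k + (- e) * L d k)"
        by (simp add: F_def ip_def power2_eq_square)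
      then show ?thesis using min[OF d[OF that]] Fh ip_expand[of m h "- e" "L d"] by simp
    qed
    then have "0 \<le> - 2 * ip m h (L d)" by (rule nonneg_of_quadratic)
    then show ?thesis by (simp add: ip_commute)
  qed
  have "ip m (a j) h \<le> 0" if "j \<in> J" for j
  proof -
    \<comment> \<open>Raising one coefficient alone tests the single generator
      \<open>a j\<close>.\<close>
    have "ip m (L (\<lambda>i. if i = j then 1 else 0)) h \<le> 0" using c0 by (intro dir) simp
    moreover have "L (\<lambda>i. if i = j then 1 else 0) = a j"
      using that fin by (intro ext) (simp add: L_def if_distrib[of "(*) _"] cong: if_cong)
    ultimately show ?thesis by simp
  qed
  then have "ip m y h \<le> 0" using imp by blast
  \<comment> \<open>Shrinking all coefficients towards 0 is also admissible; it says that
    \<open>ip m (L c) h\<close> is nonnegative.\<close>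
  moreover have "ip m (L (\<lambda>j. - c j)) h \<le> 0"
    using c0 by (intro dir) (simp add: mult_left_le_one_le)
  moreover have "ip m h h = ip m y h + ip m (L (\<lambda>j. - c j)) h"
    unfolding ip_def by (simp add: h_def L_def sum_negf left_diff_distrib sum_subtractf)
  ultimately have "ip m h h \<le> 0" by simp
  then have "\<forall>k<m. h k = 0" using ip_self_nonpos by blast
  then show ?thesis using c0 by (intro exI[of _ c]) (auto simp: h_def L_def mult.commute)
qed

section \<open>Projections onto polyhedral sets\<close>

text \<open>Unlike \<open>polyhedral\<close>, this names the constraint data, to which multipliers
  refer, and allows any index set: the primal feasible set is indexed by pairs of a block and a
  row.\<close>

definition polyset :: "nat \<Rightarrow> 'j set \<Rightarrow> ('j \<Rightarrow> nat \<Rightarrow> real) \<Rightarrow> ('j \<Rightarrow> real) \<Rightarrow> (nat \<Rightarrow> real) set" where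
  "polyset m J a b = {y \<in> vecs m. \<forall>j\<in>J. ip m (a j) y \<le> b j}"

lemma polyset_convex:
  assumes "p \<in> polyset m J a b" "u \<in> polyset m J a b" "0 \<le> e" "e \<le> 1"
  shows "(\<lambda>k. p k + e * (u - p) k) \<in> polyset m J a b"
proof -
  have "ip m (a j) (\<lambda>k. p k + e * (u - p) k) \<le> b j" if "j \<in> J" for j
  proof -
    have "ip m (a j) (\<lambda>k. p k + e * (u - p) k) = (1 - e) * ip m (a j) p + e * ip m (a j) u"
      unfolding ip_add_right ip_scale_right ip_diff_right by (simp add: algebra_simps)
    also have "\<dots> \<le> (1 - e) * b j + e * b j"
      using assms that by (intro add_mono mult_left_mono) (auto simp: polyset_def)
    finally show ?thesis by (simp add: algebra_simps)
  qed
  then show ?thesis using assms by (auto simp: polyset_def vecs_def)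
qed

text \<open>Minimality is tested on the segment from \<open>p\<close> to \<open>u\<close>, which
  convexity keeps in the set.\<close>

lemma nearest_point_variational:
  assumes p: "p \<in> polyset m J a b" and u: "u \<in> polyset m J a b"
    and min: "\<And>w. w \<in> polyset m J a b \<Longrightarrow> vnorm m (z - p) \<le> vnorm m (z - w)"
  shows "ip m (z - p) (u - p) \<le> 0"
proof -
  have "0 \<le> e * (- 2 * ip m (z - p) (u - p)) + e\<^sup>2 * ip m (u - p) (u - p)" if e: "0 < e" "e \<le> 1" for e
  proof -
    have "z - (\<lambda>k. p k + e * (u - p) k) = (\<lambda>k. (z - p) k + (- e) * (u - p) k)"
      by (auto simp: algebra_simps)
    then show ?thesis
      using min[OF polyset_convex[OF p u, of e]] e ip_expand[of m "z - p" "- e" "u - p"]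
      by (simp add: vnorm_le_iff)
  qed
  then have "0 \<le> - 2 * ip m (z - p) (u - p)" by (rule nonneg_of_quadratic)
  then show ?thesis by simp
qed

text \<open>Only the points no farther from \<open>z\<close> than a fixed member \<open>u0\<close>
  compete, and they form a compact set.\<close>

lemma nearest_point_exists:
  assumes "polyset m J a b \<noteq> {}"
  shows "\<exists>p\<in>polyset m J a b. \<forall>u\<in>polyset m J a b. vnorm m (z - p) \<le> vnorm m (z - u)"
proof -
  let ?C = "polyset m J a b"
  obtain u0 where u0: "u0 \<in> ?C" using assms by blast
  define U where "U = (?C \<inter> {x. vnorm m (z - x) \<le> vnorm m (z - u0)})"
  have "?C = {x. \<forall>k\<in>{m..}. x k = 0} \<inter> (\<Inter>j\<in>J. {x. ip m (a j) x \<le> b j})"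
    by (auto simp: polyset_def vecs_def)
  moreover have "closed {x. ip m (a j) x \<le> b j}" for j
    unfolding ip_def by (intro closed_Collect_le continuous_intros)
  ultimately have "closed ?C"
    by (simp only:) (intro closed_Int closed_INT closed_coordinates_zero ballI)
  moreover have cont: "continuous_on S (\<lambda>x. vnorm m (z - x))" for S
    unfolding vnorm_def ip_def minus_apply by (intro continuous_intros)
  then have "closed {x. vnorm m (z - x) \<le> vnorm m (z - u0)}"
    by (intro closed_Collect_le) auto
  ultimately have closed_U: "closed U" unfolding U_def by (rule closed_Int)
  have U_eq: "U = U \<inter> {x. \<forall>k. \<bar>x k\<bar> \<le> (if k < m then \<bar>z k\<bar> + vnorm m (z - u0) else 0)}"
  proof -
    have "\<bar>x k\<bar> \<le> \<bar>z k\<bar> + vnorm m (z - u0)" if "x \<in> U" "k < m" for x k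
      using coordinate_le_vnorm[OF that(2), of "z - x"] that(1) unfolding U_def by force
    then show ?thesis by (auto simp: U_def polyset_def vecs_def)
  qed
  have "compact U" by (subst U_eq) (rule closed_Int_compact[OF closed_U compact_box])
  moreover have "U \<noteq> {}" using u0 by (auto simp: U_def)
  ultimately obtain p where p: "p \<in> U" "\<And>x. x \<in> U \<Longrightarrow> vnorm m (z - p) \<le> vnorm m (z - x)"
    using continuous_attains_inf[OF _ _ cont] by metis
  have "vnorm m (z - p) \<le> vnorm m (z - u)" if "u \<in> ?C" for u
  proof (cases "u \<in> U")
    case True
    then show ?thesis by (rule p(2))
  next
    case False
    then have "vnorm m (z - u0) < vnorm m (z - u)" using that by (simp add: U_def)
    moreover have "vnorm m (z - p) \<le> vnorm m (z - u0)" using p(1) by (simp add: U_def)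
    ultimately show ?thesis by linarith
  qed
  then show ?thesis using p(1) by (auto simp: U_def)
qed

text \<open>Justifies the definite description in \<open>proj\<close>. Adding the variational
  inequalities of two nearest points makes them agree below \<open>m\<close>; all other coordinates
  vanish.\<close>

lemma proj_polyset:
  fixes z :: "nat \<Rightarrow> real"
  assumes "polyset m J a b \<noteq> {}"
  defines "p \<equiv> proj m (polyset m J a b) z"
  shows "p \<in> polyset m J a b" and "u \<in> polyset m J a b \<Longrightarrow> ip m (z - p) (u - p) \<le> 0"
proof -
  let ?C = "polyset m J a b"
  have "\<exists>!q. q \<in> ?C \<and> (\<forall>u\<in>?C. vnorm m (z - q) \<le> vnorm m (z - u))"
  proof -
    obtain q where q: "q \<in> ?C" "\<forall>u\<in>?C. vnorm m (z - q) \<le> vnorm m (z - u)"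
      using nearest_point_exists[OF assms(1)] by blast
    moreover have "q' = q" if q': "q' \<in> ?C" "\<forall>u\<in>?C. vnorm m (z - q') \<le> vnorm m (z - u)" for q'
    proof
      fix k
      have "ip m (z - q) (q' - q) \<le> 0" "ip m (z - q') (q - q') \<le> 0"
        using q q' by (auto intro: nearest_point_variational)
      then have "ip m (q' - q) (q' - q) \<le> 0"
        by (simp add: ip_diff_left ip_diff_right)
      then show "q' k = q k"
        using ip_self_nonpos[of m "q' - q" k] q(1) q'(1)
        by (cases "k < m") (auto simp: polyset_def vecs_def)
    qed
    ultimately show ?thesis by blast
  qed
  from theI'[OF this] have "p \<in> ?C \<and> (\<forall>u\<in>?C. vnorm m (z - p) \<le> vnorm m (z - u))"
    unfolding p_def proj_def .
  then show "p \<in> ?C" and "u \<in> ?C \<Longrightarrow> ip m (z - p) (u - p) \<le> 0"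
    by (auto intro: nearest_point_variational)
qed

text \<open>Farkas' lemma for the constraints active at \<open>p\<close>. A direction
  \<open>h\<close> compatible with them can be followed for some positive \<open>e\<close>, since
  the finitely many inactive constraints have room to spare; normality then gives the premise of
  \<open>farkas\<close>.\<close>

lemma normal_cone_polyset:
  assumes fin: "finite J" and p: "p \<in> polyset m J a b"
    and normal: "\<And>u. u \<in> polyset m J a b \<Longrightarrow> ip m y (u - p) \<le> 0"
  shows "\<exists>c. (\<forall>j\<in>J. 0 \<le> c j \<and> c j * (b j - ip m (a j) p) = 0) \<and> (\<forall>k<m. y k = (\<Sum>j\<in>J. c j * a j k))"
proof -
  define Act where "Act = {j \<in> J. ip m (a j) p = b j}"
  have "ip m y h \<le> 0" if h: "\<forall>j\<in>Act. ip m (a j) h \<le> 0" for h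
  proof -
    have "\<forall>\<^sub>F e in at_right 0. ip m (a j) p + e * ip m (a j) h \<le> b j" if j: "j \<in> J" for j
    proof (cases "j \<in> Act")
      case True
      have "\<forall>\<^sub>F e in at_right (0::real). 0 < e" by (simp add: eventually_at_right_less)
      then show ?thesis
        by eventually_elim (use True h in \<open>auto simp: Act_def mult_nonneg_nonpos\<close>)
    next
      case False
      then have "ip m (a j) p < b j" using j p by (force simp: Act_def polyset_def)
      moreover have "((\<lambda>e. ip m (a j) p + e * ip m (a j) h) \<longlongrightarrow> ip m (a j) p + 0 * ip m (a j) h) (at_right 0)"
        by (intro tendsto_intros)
      ultimately have "\<forall>\<^sub>F e in at_right 0. ip m (a j) p + e * ip m (a j) h < b j"
        by (intro order_tendstoD) auto
      then show ?thesis by eventually_elim simp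
    qed
    then have "\<forall>\<^sub>F e in at_right 0. \<forall>j\<in>J. ip m (a j) p + e * ip m (a j) h \<le> b j"
      using fin by (simp add: eventually_ball_finite_distrib)
    then have "\<forall>\<^sub>F e in at_right 0. 0 < e \<and> (\<forall>j\<in>J. ip m (a j) p + e * ip m (a j) h \<le> b j)"
      using eventually_at_right_less by eventually_elim simp
    from eventually_happens'[OF trivial_limit_at_right_real this]
    obtain e where e: "0 < e" "\<And>j. j \<in> J \<Longrightarrow> ip m (a j) p + e * ip m (a j) h \<le> b j"
      by blast
    \<comment> \<open>Cut off beyond \<open>m\<close>, because \<open>h\<close> need not lie in
      \<open>vecs m\<close>.\<close>
    define u where "u k = (if k < m then p k + e * h k else 0)" for k
    have "ip m (a j) u = ip m (a j) p + e * ip m (a j) h" for j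
    proof -
      have "ip m (a j) u = ip m (a j) (\<lambda>k. p k + e * h k)" by (intro ip_cong) (auto simp: u_def)
      then show ?thesis by (simp add: ip_add_right ip_scale_right)
    qed
    then have "u \<in> polyset m J a b" using e(2) by (auto simp: polyset_def u_def vecs_def)
    then have "ip m y (u - p) \<le> 0" by (rule normal)
    also have "ip m y (u - p) = ip m y (\<lambda>k. e * h k)" by (intro ip_cong) (auto simp: u_def)
    finally show ?thesis using e(1) by (simp add: ip_scale_right mult_le_0_iff)
  qed
  then obtain c where c: "\<forall>j\<in>Act. 0 \<le> c j" "\<forall>k<m. y k = (\<Sum>j\<in>Act. c j * a j k)"
    using farkas[of Act m a y] fin by (auto simp: Act_def)
  have "(\<Sum>j\<in>Act. c j * a j k) = (\<Sum>j\<in>J. (if j \<in> Act then c j else 0) * a j k)" for k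
    using fin by (intro sum.mono_neutral_cong_left) (auto simp: Act_def)
  \<comment> \<open>Inactive constraints receive multiplier 0, which is complementary
    slackness.\<close>
  then show ?thesis using c
    by (intro exI[of _ "\<lambda>j. if j \<in> Act then c j else 0"]) (auto simp: Act_def)
qed

section \<open>The largest eigenvalue of a Gram matrix\<close>

lemma orthogonal_eigenvectors:
  assumes "mtv A p n (mv A p n x) = (\<lambda>k. s * x k)" "mtv A p n (mv A p n y) = (\<lambda>k. t * y k)" "s \<noteq> t"
  shows "ip n x y = 0"
proof -
  have "s * ip n x y = ip p (mv A p n x) (mv A p n y)"
    using assms(1) by (metis ip_scale_left mtv_adjoint)
  also have "\<dots> = t * ip n x y"
    using assms(2) by (metis ip_scale_right mv_adjoint)
  finally show ?thesis using assms(3) by simp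
qed

text \<open>Bessel's inequality for each coordinate vector. Summed over the \<open>n\<close>
  coordinates, its left-hand sides give the squared norms of all the \<open>w s\<close>, that is,
  their number.\<close>

lemma card_orthonormal_le:
  fixes w :: "'i \<Rightarrow> nat \<Rightarrow> real"
  assumes fin: "finite F" and unit: "\<And>s. s \<in> F \<Longrightarrow> ip n (w s) (w s) = 1"
    and orth: "\<And>s t. s \<in> F \<Longrightarrow> t \<in> F \<Longrightarrow> s \<noteq> t \<Longrightarrow> ip n (w s) (w t) = 0"
  shows "card F \<le> n"
proof -
  have bessel: "(\<Sum>s\<in>F. (w s k)\<^sup>2) \<le> 1" if k: "k < n" for k
  proof -
    define d where "d i = (if i = k then 1 else 0 :: real)" for i
    \<comment> \<open>The orthogonal projection of the coordinate vector \<open>d\<close> onto the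
      span of the \<open>w s\<close>.\<close>
    define g where "g i = (\<Sum>s\<in>F. w s k * w s i)" for i
    have d: "ip n d u = u k" for u
      using k by (simp add: ip_def d_def of_bool_def if_distrib if_distribR cong: if_cong)
    have "ip n g (w t) = w t k" if t: "t \<in> F" for t
    proof -
      have "ip n g (w t) = (\<Sum>s\<in>F. w s k * ip n (w s) (w t))"
        unfolding g_def by (rule ip_sum_left)
      also have "\<dots> = (\<Sum>s\<in>F. if s = t then w t k else 0)"
        using t by (intro sum.cong) (auto simp: unit orth)
      finally show ?thesis using fin t by simp
    qed
    then have "ip n g g = (\<Sum>s\<in>F. w s k * w s k)"
      using ip_sum_left[of n "\<lambda>s. w s k" w F g] by (simp add: g_def[abs_def] ip_commute)
    then have gg: "ip n g g = g k" by (simp add: g_def)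
    have "0 \<le> ip n (d - g) (d - g)" by simp
    also have "\<dots> = 1 - g k"
      by (simp add: ip_diff_left ip_diff_right d gg ip_commute[of n g d]) (simp add: d_def)
    finally show ?thesis by (simp add: g_def power2_eq_square)
  qed
  have "real (card F) = (\<Sum>s\<in>F. ip n (w s) (w s))" by (simp add: unit)
  also have "\<dots> = (\<Sum>k<n. \<Sum>s\<in>F. (w s k)\<^sup>2)"
    unfolding ip_def by (subst sum.swap) (simp add: power2_eq_square)
  also have "\<dots> \<le> (\<Sum>k<n. 1)" using bessel by (intro sum_mono) auto
  finally show ?thesis by simp
qed

text \<open>Makes the \<open>Max\<close> in \<open>lambda_max\<close> meaningful. Normalised
  eigenvectors for \<open>n + 1\<close> different eigenvalues would be orthonormal.\<close>

lemma finite_gram_eigenvalues: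
  "finite {s. \<exists>x\<in>vecs n. x \<noteq> (\<lambda>_. 0) \<and> mtv A p n (mv A p n x) = (\<lambda>k. s * x k)}" (is "finite ?S")
proof (rule ccontr)
  assume "infinite ?S"
  then obtain F where F: "F \<subseteq> ?S" "finite F" "card F = Suc n"
    using infinite_arbitrarily_large by blast
  then have "\<forall>s\<in>F. \<exists>x. x \<in> vecs n \<and> x \<noteq> (\<lambda>_. 0) \<and> mtv A p n (mv A p n x) = (\<lambda>k. s * x k)" by blast
  then obtain x where x: "\<And>s. s \<in> F \<Longrightarrow> x s \<in> vecs n" "\<And>s. s \<in> F \<Longrightarrow> x s \<noteq> (\<lambda>_. 0)"
    "\<And>s. s \<in> F \<Longrightarrow> mtv A p n (mv A p n (x s)) = (\<lambda>k. s * x s k)" by metis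
  define w where "w s k = (1 / vnorm n (x s)) * x s k" for s k
  have "vnorm n (x s) \<noteq> 0" if "s \<in> F" for s
  proof
    assume "vnorm n (x s) = 0"
    then have "ip n (x s) (x s) \<le> 0" by (simp add: vnorm_def)
    then have "x s k = 0" for k
      using ip_self_nonpos[of n "x s" k] x(1)[OF that] by (cases "k < n") (auto simp: vecs_def)
    then show False using x(2)[OF that] by auto
  qed
  then have "ip n (w s) (w s) = 1" if "s \<in> F" for s
    using that unfolding w_def[abs_def] ip_scale_left ip_scale_right
    by (simp add: power2_eq_square flip: vnorm_sq)
  moreover have "ip n (w s) (w t) = 0" if "s \<in> F" "t \<in> F" "s \<noteq> t" for s t
    unfolding w_def[abs_def] ip_scale_left ip_scale_right
    using orthogonal_eigenvectors[OF x(3) x(3)] that by simp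
  ultimately have "card F \<le> n" using F(2) by (intro card_orthonormal_le) auto
  then show False using F(3) by simp
qed

text \<open>The quadratic form attains its maximum \<open>L\<close> on the compact unit sphere, and
  first-order optimality makes the maximizer an eigenvector for \<open>L\<close>.\<close>

lemma rayleigh_maximizer:
  assumes "n \<ge> 1"
  shows "\<exists>L. (\<exists>x\<in>vecs n. x \<noteq> (\<lambda>_. 0) \<and> mtv A p n (mv A p n x) = (\<lambda>k. L * x k)) \<and>
    (\<forall>x. ip p (mv A p n x) (mv A p n x) \<le> L * ip n x x)"
proof -
  define q where "q x = ip p (mv A p n x) (mv A p n x)" for x
  define U where "U = {x \<in> vecs n. ip n x x = 1}"
  have "U = {x. \<forall>k. \<bar>x k\<bar> \<le> (if k < n then 1 else 0)} \<inter> {x. ip n x x = 1}"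
  proof -
    have "\<bar>x k\<bar> \<le> 1" if "ip n x x = 1" "k < n" for x k
      using coordinate_le_vnorm[OF that(2), of x] that(1) by (simp add: vnorm_def)
    moreover have "x k = 0" if "\<forall>k. \<bar>x k\<bar> \<le> (if k < n then 1 else 0)" "k \<ge> n" for x :: "nat \<Rightarrow> real" and k
      using that(1)[rule_format, of k] that(2) by simp
    ultimately show ?thesis by (auto simp: U_def vecs_def)
  qed
  moreover have "closed {x. ip n x x = 1}"
    unfolding ip_def by (intro closed_Collect_eq continuous_intros)
  ultimately have "compact U" by (simp add: compact_Int_closed compact_box)
  moreover have "(\<lambda>k. if k = 0 then 1 else 0) \<in> U"
    using assms by (simp add: U_def vecs_def ip_def if_distrib if_distribR cong: if_cong)
  moreover have "q = (\<lambda>x. \<Sum>j<p. (\<Sum>k<n. A j k * x k) * (\<Sum>k<n. A j k * x k))"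
    by (intro ext) (simp add: q_def ip_def mv_def)
  then have "continuous_on U q" by (simp only:) (intro continuous_intros)
  ultimately obtain x0 where x0: "x0 \<in> U" "\<And>x. x \<in> U \<Longrightarrow> q x \<le> q x0"
    using continuous_attains_sup[of U q] by blast
  define L where "L = q x0"
  have max: "q x \<le> L * ip n x x" for x
  proof (cases "vnorm n x = 0")
    case True
    then have "ip n x x \<le> 0" by (simp add: vnorm_def)
    then have "\<forall>k<n. x k = 0" using ip_self_nonpos by blast
    then show ?thesis by (simp add: q_def mv_def ip_def)
  next
    case False
    define u where "u k = (if k < n then 1 / vnorm n x * x k else 0)" for k
    have "ip n u u = ip n (\<lambda>k. 1 / vnorm n x * x k) (\<lambda>k. 1 / vnorm n x * x k)"
      by (intro ip_cong) (auto simp: u_def)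
    also have "\<dots> = 1"
      unfolding ip_scale_left ip_scale_right using False by (simp add: power2_eq_square flip: vnorm_sq)
    finally have "u \<in> U" by (auto simp: U_def vecs_def u_def)
    then have "q u \<le> L" unfolding L_def by (rule x0(2))
    moreover have "mv A p n u = (\<lambda>j. 1 / vnorm n x * mv A p n x j)"
      by (intro ext) (simp add: mv_def u_def sum_divide_distrib)
    then have "q u = q x / (vnorm n x)\<^sup>2"
      unfolding q_def by (simp only: ip_scale_left ip_scale_right) (simp add: power2_eq_square)
    ultimately show ?thesis using False by (simp add: vnorm_sq[symmetric] field_simps)
  qed
  have ip_x0: "ip n x0 x0 = 1" and x0n: "x0 \<in> vecs n" using x0(1) by (auto simp: U_def)
  \<comment> \<open>Perturbing \<open>x0\<close> along its own eigenvector residual makes the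
    first-order condition read \<open>ip n d d \<le> 0\<close>.\<close>
  define d where "d = (\<lambda>k. mtv A p n (mv A p n x0) k - L * x0 k)"
  have "0 \<le> e * (2 * (L * ip n x0 d - ip p (mv A p n x0) (mv A p n d))) + e\<^sup>2 * (L * ip n d d - q d)"
    if "0 < e" "e \<le> 1" for e
  proof -
    have "q (\<lambda>k. x0 k + e * d k) = L + e * (2 * ip p (mv A p n x0) (mv A p n d)) + e\<^sup>2 * q d"
      unfolding q_def mv_add_scale ip_expand by (simp add: L_def q_def)
    then show ?thesis
      using max[of "\<lambda>k. x0 k + e * d k"] ip_expand[of n x0 e d] ip_x0 by (simp add: algebra_simps)
  qed
  then have "0 \<le> 2 * (L * ip n x0 d - ip p (mv A p n x0) (mv A p n d))"
    by (rule nonneg_of_quadratic)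
  moreover have "ip n d d = ip p (mv A p n x0) (mv A p n d) - L * ip n x0 d"
  proof -
    have "ip n d d = ip n (mtv A p n (mv A p n x0)) d - ip n (\<lambda>k. L * x0 k) d"
      unfolding ip_diff_left[symmetric] by (intro ip_cong) (auto simp: d_def)
    then show ?thesis by (simp add: mtv_adjoint ip_scale_left)
  qed
  ultimately have "ip n d d \<le> 0" by simp
  then have "d k = 0" for k
    using ip_self_nonpos[of n d k] x0n mtv_in_vecs[of A p n "mv A p n x0"]
    by (cases "k < n") (auto simp: vecs_def d_def)
  then have "mtv A p n (mv A p n x0) = (\<lambda>k. L * x0 k)" by (auto simp: d_def)
  moreover have "x0 \<noteq> (\<lambda>_. 0)" using ip_x0 by (auto simp: ip_def)
  ultimately show ?thesis using max x0n unfolding q_def by blast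
qed

text \<open>The Rayleigh maximum is an eigenvalue and dominates all others, hence equals
  \<open>lambda_max\<close>. A coordinate vector selecting the column of a nonzero entry shows that
  it is positive.\<close>

lemma lambda_max_gram:
  fixes A :: "nat \<Rightarrow> nat \<Rightarrow> real"
  defines "g p n \<equiv> lambda_max n (\<lambda>x. mtv A p n (mv A p n x))"
  assumes nz: "j < p" "i < n" "A j i \<noteq> 0"
  shows "0 < g p n" and "ip p (mv A p n x) (mv A p n x) \<le> g p n * ip n x x"
proof -
  let ?S = "{s. \<exists>x\<in>vecs n. x \<noteq> (\<lambda>_. 0) \<and> mtv A p n (mv A p n x) = (\<lambda>k. s * x k)}"
  obtain L where L: "L \<in> ?S" "\<And>x. ip p (mv A p n x) (mv A p n x) \<le> L * ip n x x"
    using rayleigh_maximizer[of n A p] nz by auto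
  have le: "s \<le> L" if s: "s \<in> ?S" for s
  proof -
    obtain x where x: "x \<in> vecs n" "x \<noteq> (\<lambda>_. 0)" "mtv A p n (mv A p n x) = (\<lambda>k. s * x k)"
      using s by blast
    have "s * ip n x x = ip p (mv A p n x) (mv A p n x)"
      using x(3) by (metis ip_scale_left mtv_adjoint)
    then have "s * ip n x x \<le> L * ip n x x" using L(2) by simp
    moreover have "ip n x x > 0"
    proof (rule ccontr)
      assume "\<not> ip n x x > 0"
      then have "x k = 0" for k
        using ip_self_nonpos[of n x k] x(1) by (cases "k < n") (auto simp: vecs_def)
      then show False using x(2) by auto
    qed
    ultimately show ?thesis by simp
  qed
  have g: "g p n = L" unfolding g_def lambda_max_def
    using finite_gram_eigenvalues L(1) le by (intro Max_eqI) auto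
  then show "ip p (mv A p n x) (mv A p n x) \<le> g p n * ip n x x" using L(2) by simp
  define e where "e k = (if k = i then 1 else 0 :: real)" for k
  have "mv A p n e j = A j i" using nz by (simp add: mv_def e_def if_distrib cong: if_cong)
  then have "0 < (mv A p n e j)\<^sup>2" using nz(3) by simp
  also have "\<dots> \<le> ip p (mv A p n e) (mv A p n e)"
    using nz(1) unfolding ip_def power2_eq_square by (intro member_le_sum[of j]) auto
  also have "\<dots> \<le> L * ip n e e" by (rule L(2))
  also have "ip n e e = 1" using nz by (simp add: ip_def e_def if_distrib if_distribR cong: if_cong)
  finally show "0 < g p n" using g by simp
qed

text \<open>A matrix and its transpose have the same norm: for the image \<open>w\<close> of
  \<open>u\<close>, Cauchy-Schwarz bounds the square of \<open>ip n w w\<close> by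
  \<open>g * ip p u u * ip n w w\<close>, and one factor cancels.\<close>

lemma gram_transpose_bound:
  assumes g: "0 \<le> g" "\<And>x. ip p (mv A p n x) (mv A p n x) \<le> g * ip n x x"
  shows "ip n (mtv A p n u) (mtv A p n u) \<le> g * ip p u u"
proof -
  define w where "w = mtv A p n u"
  have "(ip n w w)\<^sup>2 = (ip p u (mv A p n w))\<^sup>2" by (simp add: w_def mtv_adjoint)
  also have "\<dots> \<le> (vnorm p u * vnorm p (mv A p n w))\<^sup>2"
    using ip_le_vnorm[of p u "mv A p n w"] by (metis abs_ge_zero power2_abs power_mono)
  also have "\<dots> = ip p u u * ip p (mv A p n w) (mv A p n w)"
    by (simp add: power_mult_distrib vnorm_sq)
  also have "\<dots> \<le> ip p u u * (g * ip n w w)" by (intro mult_left_mono g) simp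
  finally have "ip n w w * ip n w w \<le> (g * ip p u u) * ip n w w"
    by (simp add: power2_eq_square mult_ac)
  then have "ip n w w \<le> g * ip p u u" if "0 < ip n w w"
    using that by (rule mult_right_le_imp_le)
  moreover have "0 \<le> g * ip p u u" using g(1) by simp
  ultimately show ?thesis unfolding w_def by linarith
qed

section \<open>Linear convergence of the block iteration\<close>

lemma vnorm_sum_le: "vnorm m (\<lambda>k. \<Sum>j\<in>J. c j * a j k) \<le> (\<Sum>j\<in>J. \<bar>c j\<bar> * vnorm m (a j))"
proof (induction J rule: infinite_finite_induct)
  case (insert i J)
  then show ?case
    using vnorm_add_le[of m "\<lambda>k. c i * a i k" "\<lambda>k. \<Sum>j\<in>J. c j * a j k"] by (simp add: vnorm_scale)
qed (simp_all add: vnorm_def ip_def)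

text \<open>The increments are summable by comparison with a geometric series, whose tail bounds the
  distance to the limit.\<close>

lemma geometric_steps_converge:
  fixes f :: "nat \<Rightarrow> real"
  assumes r: "0 < r" "r < 1" and step: "\<And>t. \<bar>f (Suc t) - f t\<bar> \<le> c * r ^ t"
  shows "\<exists>L. f \<longlonglongrightarrow> L \<and> (\<forall>t. \<bar>f t - L\<bar> \<le> c / (1 - r) * r ^ t)"
proof -
  have "summable (\<lambda>t. f (Suc t) - f t)"
  proof (rule summable_comparison_test'[of "\<lambda>t. c * r ^ t" 0])
    show "summable (\<lambda>t. c * r ^ t)" using r by (intro summable_mult summable_geometric) simp
  qed (simp add: step)
  then have "(\<lambda>t. f 0 + (\<Sum>s<t. f (Suc s) - f s)) \<longlonglongrightarrow> f 0 + (\<Sum>s. f (Suc s) - f s)"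
    by (intro tendsto_intros summable_LIMSEQ)
  then obtain L where L: "f \<longlonglongrightarrow> L" by (auto simp: sum_lessThan_telescope)
  have c: "0 \<le> c" using step[of 0] by simp
  \<comment> \<open>Keeping the difference of powers, instead of \<open>r ^ t\<close> alone, makes
    the induction close exactly.\<close>
  have dist: "\<bar>f (t + s) - f t\<bar> \<le> c / (1 - r) * (r ^ t - r ^ (t + s))" for t s
  proof (induction s)
    case (Suc s)
    have "c * r ^ (t + s) = c / (1 - r) * (r ^ (t + s) - r ^ (t + Suc s))"
      using r by (simp add: field_simps)
    then show ?case using Suc step[of "t + s"] by (simp add: right_diff_distrib)
  qed simp
  have "\<bar>f t - L\<bar> \<le> c / (1 - r) * r ^ t" for t
  proof (rule LIMSEQ_le_const2)
    show "(\<lambda>s. \<bar>f t - f (s + t)\<bar>) \<longlonglongrightarrow> \<bar>f t - L\<bar>"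
      using LIMSEQ_ignore_initial_segment[OF L] by (intro tendsto_intros)
    have "\<bar>f t - f (s + t)\<bar> \<le> c / (1 - r) * r ^ t" for s
    proof -
      have "c / (1 - r) * (r ^ t - r ^ (t + s)) \<le> c / (1 - r) * r ^ t"
        using c r by (intro mult_left_mono) auto
      then show ?thesis using dist[of t s] by (simp add: abs_minus_commute add.commute)
    qed
    then show "\<exists>N. \<forall>s\<ge>N. \<bar>f t - f (s + t)\<bar> \<le> c / (1 - r) * r ^ t" by blast
  qed
  then show ?thesis using L by blast
qed

text \<open>The setting of the theorem, with the constraints of each \<open>C i\<close> fixed as
  \<open>p i\<close>, \<open>a i\<close>, \<open>b i\<close> so that multipliers can be attached to
  them.\<close>

locale block_iteration =
  fixes n l :: nat and m p :: "nat \<Rightarrow> nat"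
    and A :: "nat \<Rightarrow> nat \<Rightarrow> nat \<Rightarrow> real"
    and a :: "nat \<Rightarrow> nat \<Rightarrow> nat \<Rightarrow> real" and b :: "nat \<Rightarrow> nat \<Rightarrow> real"
    and C :: "nat \<Rightarrow> (nat \<Rightarrow> real) set"
    and v xs :: "nat \<Rightarrow> real"
    and \<gamma> :: "nat \<Rightarrow> real"
    and X Y :: "nat \<Rightarrow> nat \<Rightarrow> nat \<Rightarrow> real"
  assumes C_eq: "i \<in> {1..l} \<Longrightarrow> C i = polyset (m i) {..<p i} (a i) (b i)"
    and A_nz: "i \<in> {1..l} \<Longrightarrow> \<exists>j<m i. \<exists>k<n. A i j k \<noteq> 0"
    and xs: "xs \<in> feasible n l m A C"
    and xs_opt: "x \<in> feasible n l m A C \<Longrightarrow> vnorm n (xs - v) \<le> vnorm n (x - v)"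
    and gamma: "i \<in> {1..l} \<Longrightarrow> \<gamma> i = lambda_max n (\<lambda>x. mtv (A i) (m i) n (mv (A i) (m i) n x))"
    and Y0: "i \<in> {1..l} \<Longrightarrow> Y 0 i = (\<lambda>_. 0)"
    and X0: "X 0 l = v"
    and Xstart: "X (Suc t) 0 = X t l"
    and Xstep: "i \<in> {1..l} \<Longrightarrow> X (Suc t) i =
        (\<lambda>k. X (Suc t) (i - 1) k
              - (1 / \<gamma> i) * mtv (A i) (m i) n (mv (A i) (m i) n (X (Suc t) (i - 1))) k
              + (1 / \<gamma> i) * mtv (A i) (m i) n
                  (proj (m i) (C i) (\<lambda>j. \<gamma> i * Y t i j + mv (A i) (m i) n (X (Suc t) (i - 1)) j)) k)"
    and Ystep: "i \<in> {1..l} \<Longrightarrow> Y (Suc t) i =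
        (\<lambda>j. Y t i j + (1 / \<gamma> i) * mv (A i) (m i) n (X (Suc t) (i - 1)) j
              - (1 / \<gamma> i) * proj (m i) (C i) (\<lambda>j'. \<gamma> i * Y t i j' + mv (A i) (m i) n (X (Suc t) (i - 1)) j') j)"
begin

section \<open>One sweep as a dual update\<close>

abbreviation "Av i x \<equiv> mv (A i) (m i) n x"
abbreviation "At i y \<equiv> mtv (A i) (m i) n y"

text \<open>Both carry the index of the iterate at which the sweep starts: \<open>P t i\<close> and
  \<open>D t i\<close> belong to the step producing \<open>Y (Suc t) i\<close>.\<close>

definition "P t i = proj (m i) (C i) (\<lambda>j. \<gamma> i * Y t i j + Av i (X (Suc t) (i - 1)) j)"
definition "D t i = (\<lambda>j. Y (Suc t) i j - Y t i j)"

lemma gamma_pos: "i \<in> {1..l} \<Longrightarrow> 0 < \<gamma> i"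
  using A_nz[of i] gamma[of i] lambda_max_gram(1)[of _ "m i" _ n "A i"] by auto

lemma Av_bound: "i \<in> {1..l} \<Longrightarrow> ip (m i) (Av i x) (Av i x) \<le> \<gamma> i * ip n x x"
  using A_nz[of i] gamma[of i] lambda_max_gram(2)[of _ "m i" _ n "A i"] by auto

lemma At_bound: "i \<in> {1..l} \<Longrightarrow> ip n (At i u) (At i u) \<le> \<gamma> i * ip (m i) u u"
  using gamma_pos Av_bound by (intro gram_transpose_bound) (auto simp: less_imp_le)

lemma Av_xs: "i \<in> {1..l} \<Longrightarrow> Av i xs \<in> C i"
  using xs by (simp add: feasible_def)

lemma P_in: "i \<in> {1..l} \<Longrightarrow> P t i \<in> C i"
  unfolding P_def using C_eq[of i] Av_xs[of i] proj_polyset(1) by (metis emptyE)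

lemma Y_Suc: "i \<in> {1..l} \<Longrightarrow> \<gamma> i * Y (Suc t) i j = \<gamma> i * Y t i j + Av i (X (Suc t) (i - 1)) j - P t i j"
  using gamma_pos[of i] by (simp add: Ystep P_def field_simps)

lemma P_eq: "i \<in> {1..l} \<Longrightarrow> P t i = (\<lambda>j. Av i (X (Suc t) (i - 1)) j - \<gamma> i * D t i j)"
  using Y_Suc[of i t] by (auto simp: D_def algebra_simps)

text \<open>The new block is the residual of a projection divided by \<open>\<gamma> i\<close>,
  hence normal to \<open>C i\<close> at the projected point. So the support function at
  \<open>Y (Suc t) i\<close> is attained at \<open>P t i\<close>.\<close>

lemma Y_normal:
  assumes i: "i \<in> {1..l}" and u: "u \<in> C i"
  shows "ip (m i) (Y (Suc t) i) (u - P t i) \<le> 0"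
proof -
  let ?z = "\<lambda>j. \<gamma> i * Y t i j + Av i (X (Suc t) (i - 1)) j"
  have "ip (m i) (?z - P t i) (u - P t i) \<le> 0"
    using proj_polyset(2)[of "m i" "{..<p i}" "a i" "b i" u ?z] u Av_xs[OF i]
    unfolding P_def C_eq[OF i] by blast
  also have "?z - P t i = (\<lambda>j. \<gamma> i * Y (Suc t) i j)" by (intro ext) (simp add: Y_Suc[OF i])
  finally have "\<gamma> i * ip (m i) (Y (Suc t) i) (u - P t i) \<le> 0" unfolding ip_scale_left .
  then show ?thesis using gamma_pos[OF i] by (simp add: mult_le_0_iff)
qed

text \<open>Shows that the primal update only tracks the dual one: both projection terms combine to
  the transpose applied to the block step.\<close>

lemma X_step:
  assumes i: "i \<in> {1..l}"
  shows "X (Suc t) i = (\<lambda>k. X (Suc t) (i - 1) k - At i (D t i) k)"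
proof
  fix k
  have "\<gamma> i * At i (D t i) k = At i (\<lambda>j. \<gamma> i * D t i j) k" by (simp add: mtv_scale)
  also have "(\<lambda>j. \<gamma> i * D t i j) = Av i (X (Suc t) (i - 1)) - P t i" by (simp add: P_eq[OF i] fun_eq_iff)
  also have "At i \<dots> k = At i (Av i (X (Suc t) (i - 1))) k - At i (P t i) k" by (simp add: mtv_diff)
  finally have "At i (D t i) k = (1 / \<gamma> i) * At i (Av i (X (Suc t) (i - 1))) k - (1 / \<gamma> i) * At i (P t i) k"
    using gamma_pos[OF i] by (simp add: field_simps)
  then show "X (Suc t) i k = X (Suc t) (i - 1) k - At i (D t i) k"
    using Xstep[OF i, of t] by (simp add: P_def)
qed

lemma X_partial: "i \<le> l \<Longrightarrow> X (Suc t) i k = X t l k - (\<Sum>i'=1..i. At i' (D t i') k)"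
  by (induction i) (simp_all add: Xstart X_step)

text \<open>The invariant linking the two sequences. It holds at the start because
  \<open>Y 0\<close> vanishes and \<open>X 0 l = v\<close>, and every sweep changes both sides
  equally.\<close>

lemma X_sum: "X t l k = v k - (\<Sum>i=1..l. At i (Y t i) k)"
proof (induction t)
  case 0
  have "At i (Y 0 i) k = 0" if "i \<in> {1..l}" for i using Y0[OF that] by (simp add: mtv_def)
  then show ?case by (simp add: X0)
next
  case (Suc t)
  have "At i (D t i) = At i (Y (Suc t) i) - At i (Y t i)" for i
    using mtv_diff[of "A i" "m i" n "Y (Suc t) i" "Y t i"] by (simp add: D_def fun_diff_def)
  then show ?case using Suc by (simp add: X_partial sum_subtractf)
qed

text \<open>\<open>S t i\<close> is the value of the support function of \<open>C i\<close> at \<open>Y t i\<close>, and \<open>E t\<close> is the dual gap.\<close>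

definition "S t i = (case t of 0 \<Rightarrow> 0 | Suc s \<Rightarrow> ip (m i) (Y t i) (P s i))"
definition "E t = (1/2) * ip n (X t l - xs) (X t l - xs) + (\<Sum>i=1..l. S t i - ip (m i) (Y t i) (Av i xs))"

lemma S_Suc: "S (Suc t) i = ip (m i) (Y (Suc t) i) (P t i)"
  by (simp add: S_def)

lemma S_ge: "i \<in> {1..l} \<Longrightarrow> u \<in> C i \<Longrightarrow> ip (m i) (Y t i) u \<le> S t i"
  using Y_normal[of i u "t - 1"] by (cases t) (auto simp: S_def Y0 ip_diff_right, simp add: ip_def)

lemma S_attained: "i \<in> {1..l} \<Longrightarrow> \<exists>u\<in>C i. S t i = ip (m i) (Y t i) u"
proof (cases t)
  case 0
  moreover assume "i \<in> {1..l}"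
  ultimately show ?thesis using Av_xs[of i] by (intro bexI[of _ "Av i xs"]) (auto simp: S_def Y0 ip_def)
qed (auto simp: S_def P_in)

lemma supp_fn_Y: "i \<in> {1..l} \<Longrightarrow> supp_fn (m i) (C i) (Y t i) = ereal (S t i)"
  unfolding supp_fn_def using S_ge S_attained[of i t] by (intro SUP_eqI) auto

section \<open>Sufficient decrease of the dual gap\<close>

lemma S_gap_nonneg: "i \<in> {1..l} \<Longrightarrow> 0 \<le> S t i - ip (m i) (Y t i) (Av i xs)"
  using S_ge[OF _ Av_xs] by simp

text \<open>Turns any rate for the dual gap into a rate for the primal error, with a square
  root.\<close>

lemma half_dist_le_E: "(1/2) * ip n (X t l - xs) (X t l - xs) \<le> E t"
proof -
  have "0 \<le> (\<Sum>i=1..l. S t i - ip (m i) (Y t i) (Av i xs))"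
    by (intro sum_nonneg S_gap_nonneg)
  then show ?thesis unfolding E_def by simp
qed

lemma E_nonneg: "0 \<le> E t"
  using half_dist_le_E[of t] ip_self_nonneg[of n "X t l - xs"] by linarith

lemma S_gap_le_E: "i \<in> {1..l} \<Longrightarrow> S t i - ip (m i) (Y t i) (Av i xs) \<le> E t"
proof -
  assume "i \<in> {1..l}"
  then have "S t i - ip (m i) (Y t i) (Av i xs) \<le> (\<Sum>i=1..l. S t i - ip (m i) (Y t i) (Av i xs))"
    using S_gap_nonneg by (intro member_le_sum) auto
  then show ?thesis unfolding E_def using ip_self_nonneg[of n "X t l - xs"] by linarith
qed

text \<open>Since \<open>P t i\<close> equals \<open>Av i\<close> of the current point minus
  \<open>\<gamma> i * D t i\<close>, the linear terms leave a gain of \<open>\<gamma> i\<close>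
  times the squared step. The curvature term, bounded by \<open>At_bound\<close>, costs at most half
  of it. The old support value enters through its lower bound at \<open>P t i\<close>.\<close>

lemma block_decrease:
  assumes i: "i \<in> {1..l}"
  shows "\<gamma> i / 2 * ip (m i) (D t i) (D t i) \<le>
    ((1/2) * ip n (X (Suc t) (i - 1) - xs) (X (Suc t) (i - 1) - xs)
      - (1/2) * ip n (X (Suc t) i - xs) (X (Suc t) i - xs))
    + ((S t i - ip (m i) (Y t i) (Av i xs)) - (S (Suc t) i - ip (m i) (Y (Suc t) i) (Av i xs)))"
proof -
  let ?x = "X (Suc t) (i - 1)"
  have "X (Suc t) i - xs = (\<lambda>k. (?x - xs) k + (- 1) * At i (D t i) k)"
    by (auto simp: X_step[OF i])
  then have "ip n (X (Suc t) i - xs) (X (Suc t) i - xs) = ip n (?x - xs) (?x - xs)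
      - 2 * ip n (?x - xs) (At i (D t i)) + ip n (At i (D t i)) (At i (D t i))"
    by (simp only: ip_expand[of n "?x - xs" "- 1" "At i (D t i)"]) simp
  moreover have "ip n (?x - xs) (At i (D t i)) = ip (m i) (D t i) (Av i ?x) - ip (m i) (D t i) (Av i xs)"
    by (simp add: mv_diff mv_adjoint[symmetric] ip_diff_left ip_commute[of "m i" "D t i"])
  moreover note At_bound[OF i, of "D t i"]
  moreover have Dz: "ip (m i) (D t i) z = ip (m i) (Y (Suc t) i) z - ip (m i) (Y t i) z" for z
    using ip_diff_left[of "m i" "Y (Suc t) i" "Y t i" z] by (simp add: D_def fun_diff_def)
  moreover have "ip (m i) (D t i) (P t i) = ip (m i) (D t i) (Av i ?x) - \<gamma> i * ip (m i) (D t i) (D t i)"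
    using ip_diff_right[of "m i" "D t i" "Av i ?x" "\<lambda>j. \<gamma> i * D t i j"]
    by (simp add: P_eq[OF i] ip_scale_right fun_diff_def)
  moreover have "ip (m i) (Y t i) (P t i) \<le> S t i" by (intro S_ge i P_in)
  ultimately show ?thesis
    using Dz[of "Av i xs"] Dz[of "P t i"] unfolding S_Suc by linarith
qed

text \<open>The blockwise estimates are summed; the quadratic terms telescope along the sweep, which
  runs from \<open>X t l\<close> to \<open>X (Suc t) l\<close>.\<close>

lemma decrease: "(\<Sum>i=1..l. \<gamma> i / 2 * ip (m i) (D t i) (D t i)) \<le> E t - E (Suc t)"
proof -
  define \<phi> where "\<phi> i = (1/2) * ip n (X (Suc t) i - xs) (X (Suc t) i - xs)" for i
  have "(\<Sum>i=1..l. \<gamma> i / 2 * ip (m i) (D t i) (D t i)) \<le>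
      (\<Sum>i=1..l. (\<phi> (i - 1) - \<phi> i) + ((S t i - ip (m i) (Y t i) (Av i xs))
        - (S (Suc t) i - ip (m i) (Y (Suc t) i) (Av i xs))))"
    unfolding \<phi>_def by (intro sum_mono block_decrease)
  also have "\<dots> = (\<Sum>i=1..l. \<phi> (i - 1) - \<phi> i) + ((\<Sum>i=1..l. S t i - ip (m i) (Y t i) (Av i xs))
      - (\<Sum>i=1..l. S (Suc t) i - ip (m i) (Y (Suc t) i) (Av i xs)))"
    by (simp only: sum.distrib sum_subtractf)
  also have "(\<Sum>i=1..k. \<phi> (i - 1) - \<phi> i) = \<phi> 0 - \<phi> k" for k by (induction k) auto
  finally show ?thesis by (simp add: E_def \<phi>_def Xstart)
qed

lemma D_bound:
  assumes i: "i \<in> {1..l}"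
  shows "vnorm (m i) (D t i) \<le> sqrt (2 / \<gamma> i) * sqrt (E t - E (Suc t))"
proof -
  have "\<gamma> i / 2 * ip (m i) (D t i) (D t i) \<le> (\<Sum>i=1..l. \<gamma> i / 2 * ip (m i) (D t i) (D t i))"
    using i gamma_pos by (intro member_le_sum) (auto simp: less_imp_le)
  with decrease[of t] have "\<gamma> i / 2 * ip (m i) (D t i) (D t i) \<le> E t - E (Suc t)" by linarith
  then have "ip (m i) (D t i) (D t i) \<le> 2 / \<gamma> i * (E t - E (Suc t))"
    using gamma_pos[OF i] by (simp add: field_simps)
  then show ?thesis unfolding vnorm_def real_sqrt_mult[symmetric] by simp
qed

lemma E_Suc_le: "E (Suc t) \<le> E t"
proof -
  have "0 \<le> (\<Sum>i=1..l. \<gamma> i / 2 * ip (m i) (D t i) (D t i))"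
    using gamma_pos by (intro sum_nonneg) (auto simp: less_imp_le)
  then show ?thesis using decrease[of t] by linarith
qed

lemma E_le_E0: "E t \<le> E 0"
  by (induction t) (auto intro: order_trans[OF E_Suc_le])

section \<open>Dual optimality conditions and an upper bound for the gap\<close>

definition "dual_sol = {y. (\<forall>k<n. (\<Sum>i=1..l. At i (y i) k) = v k - xs k) \<and>
  (\<forall>i\<in>{1..l}. \<forall>u\<in>C i. ip (m i) (y i) (u - Av i xs) \<le> 0)}"

text \<open>The vectors \<open>P t i - Av i (X (Suc t) l)\<close> form a subgradient of the dual
  objective at \<open>Y (Suc t)\<close>: the first term belongs to the support function, the second
  is the gradient of the quadratic. The bound is the subgradient inequality towards the solution
  \<open>y\<close>, followed by Cauchy-Schwarz.\<close>

lemma gap_upper: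
  assumes y: "y \<in> dual_sol"
  shows "E (Suc t) \<le> (\<Sum>i=1..l. vnorm (m i) (Y (Suc t) i - y i) * vnorm (m i) (P t i - Av i (X (Suc t) l)))"
proof -
  define W where "W = X (Suc t) l - xs"
  have "ip n W W = - ip n (\<lambda>k. \<Sum>i=1..l. 1 * At i (Y (Suc t) i - y i) k) W"
  proof -
    have "W k = (-1) * (\<Sum>i=1..l. 1 * At i (Y (Suc t) i - y i) k)" if "k < n" for k
      using y that X_sum[of "Suc t" k] by (simp add: W_def dual_sol_def mtv_diff sum_subtractf)
    then have "ip n W W = ip n (\<lambda>k. (-1) * (\<Sum>i=1..l. 1 * At i (Y (Suc t) i - y i) k)) W"
      by (intro ip_cong) auto
    then show ?thesis unfolding ip_scale_left by simp
  qed
  also have "\<dots> = - (\<Sum>i=1..l. ip (m i) (Y (Suc t) i - y i) (Av i W))"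
    unfolding ip_sum_left by (simp add: mtv_adjoint)
  finally have W: "ip n W W = (\<Sum>i=1..l. - ip (m i) (Y (Suc t) i - y i) (Av i W))"
    by (simp add: sum_negf)
  \<comment> \<open>The factor 1/2 is given away so that the quadratic term becomes the pairing
    \<open>W\<close> of the difference \<open>Y (Suc t) - y\<close> with
    \<open>Av i W\<close>.\<close>
  have "E (Suc t) \<le> ip n W W + (\<Sum>i=1..l. S (Suc t) i - ip (m i) (Y (Suc t) i) (Av i xs))"
    using ip_self_nonneg[of n W] by (simp add: E_def W_def)
  also have "\<dots> = (\<Sum>i=1..l. S (Suc t) i - ip (m i) (Y (Suc t) i) (Av i xs)
      - ip (m i) (Y (Suc t) i - y i) (Av i W))"
    by (simp add: W sum_subtractf sum_negf)
  also have "\<dots> \<le> (\<Sum>i=1..l. vnorm (m i) (Y (Suc t) i - y i) * vnorm (m i) (P t i - Av i (X (Suc t) l)))"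
  proof (rule sum_mono)
    fix i assume i: "i \<in> {1..l}"
    have "ip (m i) (y i) (P t i - Av i xs) \<le> 0" using y i P_in[OF i] by (auto simp: dual_sol_def)
    then have "S (Suc t) i - ip (m i) (Y (Suc t) i) (Av i xs) - ip (m i) (Y (Suc t) i - y i) (Av i W)
        \<le> ip (m i) (Y (Suc t) i - y i) (P t i - Av i (X (Suc t) l))"
      by (simp add: S_Suc W_def mv_diff ip_diff_left ip_diff_right)
    also have "\<dots> \<le> vnorm (m i) (Y (Suc t) i - y i) * vnorm (m i) (P t i - Av i (X (Suc t) l))"
      using ip_le_vnorm by (meson abs_le_D1)
    finally show "S (Suc t) i - ip (m i) (Y (Suc t) i) (Av i xs) - ip (m i) (Y (Suc t) i - y i) (Av i W)
        \<le> vnorm (m i) (Y (Suc t) i - y i) * vnorm (m i) (P t i - Av i (X (Suc t) l))" .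
  qed
  finally show ?thesis .
qed

text \<open>With \<open>X (Suc t) (i - 1)\<close> in place of the final point the difference would
  be exactly \<open>- \<gamma> i * D t i\<close>; the correction comes from the updates of blocks
  \<open>i\<close> to \<open>l\<close>. Each part is at most the square of \<open>g\<close> times
  the total step, because \<open>g\<close> dominates every \<open>sqrt (\<gamma> i)\<close> and so
  every matrix norm.\<close>

lemma residual_bound:
  defines "g \<equiv> \<Sum>i=1..l. sqrt (\<gamma> i)"
  assumes i: "i \<in> {1..l}"
  shows "vnorm (m i) (P t i - Av i (X (Suc t) l)) \<le> 2 * g\<^sup>2 * (\<Sum>i=1..l. vnorm (m i) (D t i))"
proof -
  define R where "R = (\<Sum>i=1..l. vnorm (m i) (D t i))"
  have sqrt_le: "sqrt (\<gamma> j) \<le> g" if "j \<in> {1..l}" for j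
    unfolding g_def using that gamma_pos by (intro member_le_sum) (auto simp: less_imp_le)
  have g: "0 \<le> g" unfolding g_def using gamma_pos by (intro sum_nonneg) (auto simp: less_imp_le)
  have R: "0 \<le> R" unfolding R_def by (intro sum_nonneg) simp
  have At_norm: "vnorm n (At j u) \<le> g * vnorm (m j) u" if "j \<in> {1..l}" for j u
  proof -
    have "vnorm n (At j u) \<le> sqrt (\<gamma> j) * vnorm (m j) u"
      unfolding vnorm_def real_sqrt_mult[symmetric] using At_bound[OF that] by simp
    then show ?thesis using sqrt_le[OF that] mult_right_mono[of "sqrt (\<gamma> j)" g "vnorm (m j) u"] by simp
  qed
  have "vnorm n (X (Suc t) (i - 1) - X (Suc t) l) \<le> g * R"
  proof -
    have "X (Suc t) (i - 1) k - X (Suc t) l k = (\<Sum>j=i..l. 1 * At j (D t j) k)" for k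
    proof -
      have "{1..l} = {1..i - 1} \<union> {i..l}" using i by auto
      then have "(\<Sum>j=1..l. At j (D t j) k) = (\<Sum>j=1..i - 1. At j (D t j) k) + (\<Sum>j=i..l. At j (D t j) k)"
        by (simp only:) (intro sum.union_disjoint; use i in auto)
      moreover have "i - 1 \<le> l" using i by auto
      ultimately show ?thesis using X_partial[of "i - 1" t k] X_partial[of l t k] by simp
    qed
    then have "X (Suc t) (i - 1) - X (Suc t) l = (\<lambda>k. \<Sum>j=i..l. 1 * At j (D t j) k)" by auto
    then have "vnorm n (X (Suc t) (i - 1) - X (Suc t) l) \<le> (\<Sum>j=i..l. \<bar>1\<bar> * vnorm n (At j (D t j)))"
      by (simp only: vnorm_sum_le)
    also have "\<dots> \<le> (\<Sum>j=1..l. \<bar>1\<bar> * vnorm n (At j (D t j)))"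
      using i by (intro sum_mono2) auto
    also have "\<dots> \<le> (\<Sum>j=1..l. g * vnorm (m j) (D t j))"
      using At_norm by (intro sum_mono) simp
    finally show ?thesis by (simp add: R_def sum_distrib_left)
  qed
  moreover have "vnorm (m i) (Av i (X (Suc t) (i - 1) - X (Suc t) l)) \<le> g * vnorm n (X (Suc t) (i - 1) - X (Suc t) l)"
  proof -
    have "vnorm (m i) (Av i x) \<le> sqrt (\<gamma> i) * vnorm n x" for x
      unfolding vnorm_def real_sqrt_mult[symmetric] using Av_bound[OF i] by simp
    then show ?thesis using sqrt_le[OF i] by (meson mult_right_mono order_trans vnorm_nonneg)
  qed
  ultimately have 1: "vnorm (m i) (Av i (X (Suc t) (i - 1) - X (Suc t) l)) \<le> g\<^sup>2 * R"
    using g by (smt (verit) mult.assoc mult_left_mono power2_eq_square)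
  have "\<gamma> i = sqrt (\<gamma> i) * sqrt (\<gamma> i)" using gamma_pos[OF i] by simp
  also have "\<dots> \<le> g * g" using sqrt_le[OF i] gamma_pos[OF i] g by (intro mult_mono) auto
  finally have "\<gamma> i \<le> g\<^sup>2" by (simp add: power2_eq_square)
  moreover have "vnorm (m i) (D t i) \<le> R" unfolding R_def using i by (intro member_le_sum) auto
  ultimately have 2: "\<gamma> i * vnorm (m i) (D t i) \<le> g\<^sup>2 * R" by (intro mult_mono) auto
  have "P t i - Av i (X (Suc t) l) = (\<lambda>j. Av i (X (Suc t) (i - 1) - X (Suc t) l) j + (- \<gamma> i) * D t i j)"
    by (auto simp: P_eq[OF i] mv_diff)
  then have "vnorm (m i) (P t i - Av i (X (Suc t) l))
      \<le> vnorm (m i) (Av i (X (Suc t) (i - 1) - X (Suc t) l)) + vnorm (m i) (\<lambda>j. (- \<gamma> i) * D t i j)"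
    by (simp only: vnorm_add_le)
  then show ?thesis unfolding R_def[symmetric] vnorm_scale using 1 2 gamma_pos[OF i] by simp
qed

section \<open>Multipliers and the distance to the dual solutions\<close>

abbreviation "I \<equiv> Sigma {1..l} (\<lambda>i. {..<p i})"
definition "slack i j = b i j - ip (m i) (a i j) (Av i xs)"

lemma slack_nonneg: "i \<in> {1..l} \<Longrightarrow> j < p i \<Longrightarrow> 0 \<le> slack i j"
  using Av_xs[of i] C_eq[of i] by (auto simp: slack_def polyset_def)

lemma sum_I: "(\<Sum>q\<in>I. f q) = (\<Sum>i=1..l. \<Sum>j<p i. f (i, j))"
  by (simp add: sum.Sigma)

text \<open>Pulling the constraints back through the transposes exposes the feasible set as one
  polyhedron, to which \<open>normal_cone_polyset\<close> applies.\<close>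

lemma feasible_polyset:
  "feasible n l m A C = polyset n I (\<lambda>(i, j). At i (a i j)) (\<lambda>(i, j). b i j)"
  using C_eq mv_in_vecs by (auto simp: feasible_def polyset_def mtv_adjoint)

text \<open>As \<open>xs\<close> is the nearest feasible point to \<open>v\<close>, the difference
  \<open>v - xs\<close> is normal to the feasible set at \<open>xs\<close>. The multipliers will
  witness solvability of the system in the error bound.\<close>

lemma primal_multipliers:
  "\<exists>c. (\<forall>i\<in>{1..l}. \<forall>j<p i. 0 \<le> c (i, j) \<and> c (i, j) * slack i j = 0) \<and>
    (\<forall>k<n. v k - xs k = (\<Sum>i=1..l. \<Sum>j<p i. c (i, j) * At i (a i j) k))"
proof -
  have "\<exists>c. (\<forall>q\<in>I. 0 \<le> c q \<and> c q * ((case q of (i, j) \<Rightarrow> b i j) - ip n (case q of (i, j) \<Rightarrow> At i (a i j)) xs) = 0) \<and>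
      (\<forall>k<n. (v - xs) k = (\<Sum>q\<in>I. c q * (case q of (i, j) \<Rightarrow> At i (a i j)) k))"
  proof (rule normal_cone_polyset)
    show "xs \<in> polyset n I (\<lambda>(i, j). At i (a i j)) (\<lambda>(i, j). b i j)"
      using xs by (simp only: feasible_polyset)
    show "ip n (v - xs) (u - xs) \<le> 0" if "u \<in> polyset n I (\<lambda>(i, j). At i (a i j)) (\<lambda>(i, j). b i j)" for u
      using that xs xs_opt unfolding feasible_polyset
      by (intro nearest_point_variational) (auto simp: vnorm_diff_commute[of n v])
  qed simp
  then obtain c where c:
    "\<forall>q\<in>I. 0 \<le> c q \<and> c q * ((case q of (i, j) \<Rightarrow> b i j) - ip n (case q of (i, j) \<Rightarrow> At i (a i j)) xs) = 0"
    "\<forall>k<n. (v - xs) k = (\<Sum>q\<in>I. c q * (case q of (i, j) \<Rightarrow> At i (a i j)) k)" by blast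
  have "\<forall>i\<in>{1..l}. \<forall>j<p i. 0 \<le> c (i, j) \<and> c (i, j) * slack i j = 0"
    using c(1) by (auto simp: mtv_adjoint slack_def)
  moreover have "\<forall>k<n. v k - xs k = (\<Sum>i=1..l. \<Sum>j<p i. c (i, j) * At i (a i j) k)"
    using c(2) unfolding sum_I by simp
  ultimately show ?thesis by blast
qed

text \<open>Hoffman's bound is used in the space of multipliers, where nonnegative solutions of one
  linear system produce dual solutions. \<open>primal_multipliers\<close> shows the system solvable,
  and \<open>Y_normal\<close> supplies multipliers \<open>x\<close> for the iterate after a sweep.
  Their residual is of order the square root of the gap.\<close>

lemma dual_error_bound:
  "\<exists>K\<ge>0. \<forall>t. \<exists>y\<in>dual_sol. \<forall>i\<in>{1..l}. vnorm (m i) (Y (Suc t) i - y i) \<le> K * sqrt (E (Suc t))"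
proof -
  \<comment> \<open>Rows \<open>k < n\<close> assemble the sum of the \<open>At i (y i)\<close>; row
    \<open>n\<close> is the total complementarity defect, measured by the slacks at
    \<open>xs\<close>.\<close>
  define M where "M k q = (case q of (i, j) \<Rightarrow> if k < n then At i (a i j) k else slack i j)" for k q
  obtain H where H: "H \<ge> 0" "\<And>x z. \<forall>q\<in>I. 0 \<le> x q \<Longrightarrow> \<forall>q\<in>I. 0 \<le> z q \<Longrightarrow>
    \<exists>w. (\<forall>q\<in>I. 0 \<le> w q) \<and> (\<forall>k\<in>{..n}. (\<Sum>q\<in>I. M k q * w q) = (\<Sum>q\<in>I. M k q * z q)) \<and>
      (\<Sum>q\<in>I. \<bar>w q - x q\<bar>) \<le> H * (\<Sum>k\<le>n. \<bar>(\<Sum>q\<in>I. M k q * x q) - (\<Sum>q\<in>I. M k q * z q)\<bar>)"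
    using hoffman_nonneg[of I "{..n}" M] by auto
  obtain c where c: "\<forall>i\<in>{1..l}. \<forall>j<p i. 0 \<le> c (i, j) \<and> c (i, j) * slack i j = 0"
    "\<forall>k<n. v k - xs k = (\<Sum>i=1..l. \<Sum>j<p i. c (i, j) * At i (a i j) k)"
    using primal_multipliers by blast
  have Mc: "(\<Sum>q\<in>I. M k q * c q) = (if k < n then v k - xs k else 0)" for k
  proof (cases "k < n")
    case True
    then show ?thesis using c(2) unfolding sum_I by (simp add: M_def mult.commute)
  next
    case False
    then have "M k q * c q = 0" if "q \<in> I" for q using c(1) that by (auto simp: M_def)
    then have "(\<Sum>q\<in>I. M k q * c q) = 0" by (rule sum.neutral[rule_format])
    then show ?thesis using False by simp
  qed
  define G where "G = (\<Sum>i=1..l. \<Sum>j<p i. vnorm (m i) (a i j))"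
  have G: "G \<ge> 0" unfolding G_def by (intro sum_nonneg) simp
  \<comment> \<open>\<open>G\<close> passes from multipliers to vectors, \<open>H\<close> is
    Hoffman's constant, and the bracket bounds the residual in units of
    \<open>sqrt (E (Suc t))\<close>.\<close>
  define K where "K = G * (H * (real n * sqrt 2 + sqrt (E 0)))"
  have "\<exists>y\<in>dual_sol. \<forall>i\<in>{1..l}. vnorm (m i) (Y (Suc t) i - y i) \<le> K * sqrt (E (Suc t))" for t
  proof -
    have "\<exists>\<mu>. (\<forall>j<p i. 0 \<le> \<mu> j \<and> \<mu> j * (b i j - ip (m i) (a i j) (P t i)) = 0) \<and>
        (\<forall>k<m i. Y (Suc t) i k = (\<Sum>j<p i. \<mu> j * a i j k))" if i: "i \<in> {1..l}" for i
      using normal_cone_polyset[of "{..<p i}" "P t i" "m i" "a i" "b i" "Y (Suc t) i"] P_in[OF i]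
        Y_normal[OF i] C_eq[OF i] by auto
    then have "\<exists>\<mu>. \<forall>i\<in>{1..l}. (\<forall>j<p i. 0 \<le> \<mu> i j \<and> \<mu> i j * (b i j - ip (m i) (a i j) (P t i)) = 0) \<and>
        (\<forall>k<m i. Y (Suc t) i k = (\<Sum>j<p i. \<mu> i j * a i j k))"
      by (intro bchoice ballI)
    then obtain \<mu> where \<mu>: "\<And>i j. i \<in> {1..l} \<Longrightarrow> j < p i \<Longrightarrow> 0 \<le> \<mu> i j"
      "\<And>i j. i \<in> {1..l} \<Longrightarrow> j < p i \<Longrightarrow> \<mu> i j * (b i j - ip (m i) (a i j) (P t i)) = 0"
      "\<And>i k. i \<in> {1..l} \<Longrightarrow> k < m i \<Longrightarrow> Y (Suc t) i k = (\<Sum>j<p i. \<mu> i j * a i j k)"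
      by blast
    have ipY: "ip (m i) (Y (Suc t) i) z = (\<Sum>j<p i. \<mu> i j * ip (m i) (a i j) z)" if "i \<in> {1..l}" for i z
      unfolding ip_sum_left[symmetric] using \<mu>(3)[OF that] by (intro ip_cong) auto
    define x where "x q = (case q of (i, j) \<Rightarrow> \<mu> i j)" for q
    have Mx: "(\<Sum>q\<in>I. M k q * x q) = v k - X (Suc t) l k" if "k < n" for k
    proof -
      have "At i (Y (Suc t) i) k = (\<Sum>j<p i. M k (i, j) * x (i, j))" if i: "i \<in> {1..l}" for i
      proof -
        have "At i (Y (Suc t) i) = At i (\<lambda>k. \<Sum>j<p i. \<mu> i j * a i j k)"
          using \<mu>(3)[OF i] by (intro mtv_cong) auto
        then show ?thesis using \<open>k < n\<close> by (simp add: mtv_sum M_def x_def mult.commute)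
      qed
      then show ?thesis unfolding sum_I by (simp add: X_sum)
    qed
    have Mxn: "(\<Sum>q\<in>I. M n q * x q) = (\<Sum>i=1..l. S (Suc t) i - ip (m i) (Y (Suc t) i) (Av i xs))"
    proof -
      have "(\<Sum>j<p i. M n (i, j) * x (i, j)) = S (Suc t) i - ip (m i) (Y (Suc t) i) (Av i xs)"
        if i: "i \<in> {1..l}" for i
      proof -
        \<comment> \<open>Complementarity at \<open>P t i\<close> replaces \<open>b i j\<close> by
          \<open>ip (m i) (a i j) (P t i)\<close> under the multiplier, so row \<open>n\<close>
          measures the gap in the support functions.\<close>
        have "(\<Sum>j<p i. M n (i, j) * x (i, j)) =
            (\<Sum>j<p i. \<mu> i j * ip (m i) (a i j) (P t i) - \<mu> i j * ip (m i) (a i j) (Av i xs))"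
          using \<mu>(2)[OF i] by (intro sum.cong) (auto simp: M_def x_def slack_def algebra_simps)
        then show ?thesis by (simp add: S_Suc ipY[OF i] sum_subtractf)
      qed
      then show ?thesis unfolding sum_I by simp
    qed
    obtain w where w: "\<forall>q\<in>I. 0 \<le> w q" "\<forall>k\<in>{..n}. (\<Sum>q\<in>I. M k q * w q) = (\<Sum>q\<in>I. M k q * c q)"
      "(\<Sum>q\<in>I. \<bar>w q - x q\<bar>) \<le> H * (\<Sum>k\<le>n. \<bar>(\<Sum>q\<in>I. M k q * x q) - (\<Sum>q\<in>I. M k q * c q)\<bar>)"
      using H(2)[of x c] \<mu>(1) c(1) by (auto simp: x_def)
    have low: "\<bar>(\<Sum>q\<in>I. M k q * x q) - (\<Sum>q\<in>I. M k q * c q)\<bar> = \<bar>(X (Suc t) l - xs) k\<bar>"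
      if "k < n" for k
      unfolding Mx[OF that] Mc using that by simp
    have top: "\<bar>(\<Sum>q\<in>I. M n q * x q) - (\<Sum>q\<in>I. M n q * c q)\<bar>
        = \<bar>\<Sum>i=1..l. S (Suc t) i - ip (m i) (Y (Suc t) i) (Av i xs)\<bar>"
      unfolding Mxn Mc by simp
    have "(\<Sum>k\<le>n. \<bar>(\<Sum>q\<in>I. M k q * x q) - (\<Sum>q\<in>I. M k q * c q)\<bar>)
        = (\<Sum>k<n. \<bar>(X (Suc t) l - xs) k\<bar>) + \<bar>\<Sum>i=1..l. S (Suc t) i - ip (m i) (Y (Suc t) i) (Av i xs)\<bar>"
      unfolding lessThan_Suc_atMost[symmetric] sum.lessThan_Suc
      by (intro arg_cong2[where f = "(+)"] sum.cong refl top low) simp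
    also have "\<dots> \<le> real n * (sqrt 2 * sqrt (E (Suc t))) + sqrt (E 0) * sqrt (E (Suc t))"
    proof (rule add_mono)
      have "\<bar>(X (Suc t) l - xs) k\<bar> \<le> sqrt 2 * sqrt (E (Suc t))" if "k < n" for k
      proof -
        have "\<bar>(X (Suc t) l - xs) k\<bar> \<le> vnorm n (X (Suc t) l - xs)" by (rule coordinate_le_vnorm[OF that])
        also have "\<dots> \<le> sqrt (2 * E (Suc t))"
          unfolding vnorm_def using half_dist_le_E[of "Suc t"] by (intro real_sqrt_le_mono) simp
        finally show ?thesis by (simp add: real_sqrt_mult)
      qed
      then have "(\<Sum>k<n. \<bar>(X (Suc t) l - xs) k\<bar>) \<le> (\<Sum>k<n. sqrt 2 * sqrt (E (Suc t)))"
        by (intro sum_mono) auto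
      then show "(\<Sum>k<n. \<bar>(X (Suc t) l - xs) k\<bar>) \<le> real n * (sqrt 2 * sqrt (E (Suc t)))" by simp
      have "0 \<le> (\<Sum>i=1..l. S (Suc t) i - ip (m i) (Y (Suc t) i) (Av i xs))"
        using S_gap_nonneg by (intro sum_nonneg) auto
      moreover have "(\<Sum>i=1..l. S (Suc t) i - ip (m i) (Y (Suc t) i) (Av i xs)) \<le> E (Suc t)"
        using ip_self_nonneg[of n "X (Suc t) l - xs"] by (simp add: E_def)
      \<comment> \<open>This residual is of order \<open>E\<close> itself; one square root is traded
        for the constant \<open>sqrt (E 0)\<close>.\<close>
      moreover have "E (Suc t) = sqrt (E (Suc t)) * sqrt (E (Suc t))" using E_nonneg by simp
      moreover have "\<dots> \<le> sqrt (E 0) * sqrt (E (Suc t))"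
        using E_le_E0 E_nonneg by (intro mult_right_mono) auto
      ultimately show "\<bar>\<Sum>i=1..l. S (Suc t) i - ip (m i) (Y (Suc t) i) (Av i xs)\<bar> \<le> sqrt (E 0) * sqrt (E (Suc t))"
        by linarith
    qed
    also have "\<dots> = (real n * sqrt 2 + sqrt (E 0)) * sqrt (E (Suc t))" by (simp add: algebra_simps)
    finally have wx: "(\<Sum>q\<in>I. \<bar>w q - x q\<bar>) \<le> H * ((real n * sqrt 2 + sqrt (E 0)) * sqrt (E (Suc t)))"
      using w(3) mult_left_mono[OF _ H(1)] by (meson order_trans)
    define y where "y i = (\<lambda>k. \<Sum>j<p i. w (i, j) * a i j k)" for i
    \<comment> \<open>Row \<open>n\<close> at \<open>w\<close> is a vanishing sum of nonnegative
      terms, so each of them is 0.\<close>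
    have w_slack: "w (i, j) * slack i j = 0" if "i \<in> {1..l}" "j < p i" for i j
    proof -
      have "(\<Sum>q\<in>I. M n q * w q) = 0" using w(2) Mc[of n] by simp
      moreover have "0 \<le> M n q * w q" if "q \<in> I" for q
        using that w(1) slack_nonneg by (auto simp: M_def)
      ultimately have "M n (i, j) * w (i, j) = 0"
        using that by (subst (asm) sum_nonneg_eq_0_iff) auto
      then show ?thesis by (auto simp: M_def)
    qed
    have "y \<in> dual_sol"
    proof -
      have "(\<Sum>i=1..l. At i (y i) k) = v k - xs k" if "k < n" for k
      proof -
        have "(\<Sum>i=1..l. At i (y i) k) = (\<Sum>q\<in>I. M k q * w q)"
          unfolding sum_I y_def mtv_sum using that by (simp add: M_def mult.commute)
        then show ?thesis using w(2) that Mc[of k] by simp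
      qed
      moreover have "ip (m i) (y i) (u - Av i xs) \<le> 0" if i: "i \<in> {1..l}" and u: "u \<in> C i" for i u
      proof -
        have "ip (m i) (y i) (u - Av i xs) = (\<Sum>j<p i. w (i, j) * ip (m i) (a i j) (u - Av i xs))"
          unfolding y_def by (rule ip_sum_left)
        also have "\<dots> \<le> (\<Sum>j<p i. w (i, j) * slack i j)"
          using w(1) u i C_eq[OF i]
          by (intro sum_mono mult_left_mono) (auto simp: slack_def ip_diff_right polyset_def)
        finally show ?thesis using w_slack[OF i] by simp
      qed
      ultimately show ?thesis by (simp add: dual_sol_def)
    qed
    moreover have "vnorm (m i) (Y (Suc t) i - y i) \<le> K * sqrt (E (Suc t))" if i: "i \<in> {1..l}" for i
    proof -
      have "vnorm (m i) (Y (Suc t) i - y i) = vnorm (m i) (\<lambda>k. \<Sum>j<p i. (x (i, j) - w (i, j)) * a i j k)"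
        using \<mu>(3)[OF i] by (intro vnorm_cong) (simp add: y_def x_def left_diff_distrib sum_subtractf)
      also have "\<dots> \<le> (\<Sum>j<p i. \<bar>x (i, j) - w (i, j)\<bar> * vnorm (m i) (a i j))" by (rule vnorm_sum_le)
      also have "\<dots> \<le> (\<Sum>j<p i. \<bar>w (i, j) - x (i, j)\<bar> * G)"
      proof (intro sum_mono mult_mono)
        fix j assume j: "j \<in> {..<p i}"
        have "vnorm (m i) (a i j) \<le> (\<Sum>j<p i. vnorm (m i) (a i j))"
          using j by (intro member_le_sum) auto
        also have "\<dots> \<le> G" unfolding G_def
          using i by (intro member_le_sum[of i _ "\<lambda>i. \<Sum>j<p i. vnorm (m i) (a i j)"]) (auto intro: sum_nonneg)
        finally show "vnorm (m i) (a i j) \<le> G" .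
      qed (auto simp: abs_minus_commute)
      also have "\<dots> = G * (\<Sum>j<p i. \<bar>w (i, j) - x (i, j)\<bar>)"
        by (simp add: sum_distrib_left mult.commute)
      also have "\<dots> \<le> G * (\<Sum>q\<in>I. \<bar>w q - x q\<bar>)"
        unfolding sum_I using i G
        by (intro mult_left_mono member_le_sum[of i _ "\<lambda>i. \<Sum>j<p i. \<bar>w (i, j) - x (i, j)\<bar>"]) (auto intro: sum_nonneg)
      also have "\<dots> \<le> G * (H * ((real n * sqrt 2 + sqrt (E 0)) * sqrt (E (Suc t))))"
        using wx G by (rule mult_left_mono)
      finally show ?thesis by (simp add: K_def mult.assoc)
    qed
    ultimately show ?thesis by blast
  qed
  moreover have "K \<ge> 0" unfolding K_def using G H(1) E_nonneg by simp
  ultimately show ?thesis by blast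
qed

text \<open>\<open>gap_upper\<close> bounds the new gap by distance times residual. The distance is
  of order the square root of the new gap by \<open>dual_error_bound\<close>, the residual of order
  the square root of the decrease by \<open>residual_bound\<close> and \<open>D_bound\<close>.
  Cancelling one root and squaring bounds the gap by its decrease.\<close>

lemma linear_rate: "\<exists>r. 0 < r \<and> r < 1 \<and> (\<forall>t. E (Suc t) \<le> r * E t)"
proof -
  obtain K where K: "K \<ge> 0"
    "\<And>t. \<exists>y\<in>dual_sol. \<forall>i\<in>{1..l}. vnorm (m i) (Y (Suc t) i - y i) \<le> K * sqrt (E (Suc t))"
    using dual_error_bound by blast
  define g where "g = (\<Sum>i=1..l. sqrt (\<gamma> i))"
  define h where "h = (\<Sum>i=1..l. sqrt (2 / \<gamma> i))"
  define Q where "Q = real l * K * (2 * g\<^sup>2) * h"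
  have h: "0 \<le> h" unfolding h_def using gamma_pos by (intro sum_nonneg) (auto simp: less_imp_le)
  have Q: "0 \<le> Q" unfolding Q_def using K(1) h by simp
  have bound: "E (Suc t) \<le> Q\<^sup>2 * (E t - E (Suc t))" for t
  proof -
    let ?e = "sqrt (E (Suc t))" and ?d = "sqrt (E t - E (Suc t))"
    obtain y where y: "y \<in> dual_sol" "\<forall>i\<in>{1..l}. vnorm (m i) (Y (Suc t) i - y i) \<le> K * ?e"
      using K(2) by blast
    have d: "0 \<le> ?d" using E_Suc_le[of t] by simp
    have "(\<Sum>i=1..l. vnorm (m i) (D t i)) \<le> (\<Sum>i=1..l. sqrt (2 / \<gamma> i) * ?d)"
      by (intro sum_mono D_bound)
    then have R: "(\<Sum>i=1..l. vnorm (m i) (D t i)) \<le> h * ?d" by (simp add: h_def sum_distrib_right)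
    have "E (Suc t) \<le> (\<Sum>i=1..l. (K * ?e) * (2 * g\<^sup>2 * (h * ?d)))"
    proof (rule order_trans[OF gap_upper[OF y(1)]], intro sum_mono mult_mono)
      fix i assume i: "i \<in> {1..l}"
      show "vnorm (m i) (Y (Suc t) i - y i) \<le> K * ?e" using y(2) i by blast
      have "2 * g\<^sup>2 * (\<Sum>i=1..l. vnorm (m i) (D t i)) \<le> 2 * g\<^sup>2 * (h * ?d)"
        using R by (intro mult_left_mono) auto
      then show "vnorm (m i) (P t i - Av i (X (Suc t) l)) \<le> 2 * g\<^sup>2 * (h * ?d)"
        using residual_bound[OF i, of t] unfolding g_def by linarith
    qed (use K(1) E_nonneg in auto)
    also have "\<dots> = ?e * (Q * ?d)" by (simp add: Q_def)
    finally have "?e * ?e \<le> ?e * (Q * ?d)" using E_nonneg by simp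
    then have "?e \<le> Q * ?d" if "0 < ?e"
      using that by (rule mult_left_le_imp_le)
    moreover have "0 \<le> Q * ?d" using Q d by (rule mult_nonneg_nonneg)
    ultimately have "?e \<le> Q * ?d" by linarith
    then have "?e\<^sup>2 \<le> (Q * ?d)\<^sup>2" using E_nonneg by (intro power_mono) auto
    then show ?thesis using E_nonneg E_Suc_le[of t] by (simp add: power_mult_distrib)
  qed
  \<comment> \<open>\<open>bound\<close> alone would give
    \<open>Q\<^sup>2 / (Q\<^sup>2 + 1)\<close>, which is 0 for \<open>Q = 0\<close>; adding
    monotonicity of \<open>E\<close> keeps the rate positive.\<close>
  define r where "r = (Q\<^sup>2 + 1) / (Q\<^sup>2 + 2)"
  have pos: "0 < Q\<^sup>2 + 2" by (simp add: add_nonneg_pos)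
  have r: "0 < r" "r < 1" using pos by (auto simp: r_def add_nonneg_pos)
  have "E (Suc t) \<le> r * E t" for t
  proof -
    have "(Q\<^sup>2 + 2) * E (Suc t) \<le> (Q\<^sup>2 + 1) * E t"
      using bound[of t] E_Suc_le[of t] E_nonneg[of t] by (simp add: algebra_simps)
    then show ?thesis using pos by (simp add: r_def field_simps)
  qed
  then show ?thesis using r by blast
qed

section \<open>Identification of \<open>E\<close> with the dual gap\<close>

definition "opt_val = (1/2) * ip n xs xs - (1/2) * ip n v v + ip n (v - xs) xs"

text \<open>Completes the square around \<open>v - xs\<close>. The constant \<open>opt_val\<close>
  equals minus half the squared distance from \<open>v\<close> to \<open>xs\<close>, the negative of
  the primal optimal value, so the formula exhibits strong duality.\<close>

lemma dual_obj_eq: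
  assumes s: "\<And>i. i \<in> {1..l} \<Longrightarrow> supp_fn (m i) (C i) (y i) = ereal (s i)"
  defines "w \<equiv> \<lambda>k. \<Sum>i=1..l. At i (y i) k"
  shows "dual_obj n l m A C v y = ereal (opt_val + (1/2) * ip n (w - (v - xs)) (w - (v - xs))
    + (\<Sum>i=1..l. s i - ip (m i) (y i) (Av i xs)))"
proof -
  have w: "ip n w xs = (\<Sum>i=1..l. ip (m i) (y i) (Av i xs))"
    using ip_sum_left[of n "\<lambda>_. 1" "\<lambda>i. At i (y i)" "{1..l}" xs] by (simp add: w_def mtv_adjoint)
  have "w - (v - xs) = (\<lambda>k. (w - v) k + 1 * xs k)" by auto
  then have "ip n (w - (v - xs)) (w - (v - xs)) = ip n (w - v) (w - v) + 2 * ip n (w - v) xs + ip n xs xs"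
    by (simp only: ip_expand[of n "w - v" 1 xs]) simp
  then have "(1/2) * ip n (w - v) (w - v) - (1/2) * ip n v v + (\<Sum>i=1..l. s i) =
     opt_val + (1/2) * ip n (w - (v - xs)) (w - (v - xs)) + (\<Sum>i=1..l. s i - ip (m i) (y i) (Av i xs))"
    using ip_diff_left[of n w v xs] ip_diff_left[of n v xs xs]
    unfolding opt_val_def sum_subtractf w[symmetric] by linarith
  moreover have "(\<Sum>i=1..l. supp_fn (m i) (C i) (y i)) = ereal (\<Sum>i=1..l. s i)"
    using s by simp
  ultimately show ?thesis unfolding dual_obj_def w_def[symmetric] vnorm_sq by simp
qed

lemma dual_obj_Y: "dual_obj n l m A C v (Y t) = ereal (opt_val + E t)"
proof -
  have "ip n ((\<lambda>k. \<Sum>i=1..l. At i (Y t i) k) - (v - xs)) ((\<lambda>k. \<Sum>i=1..l. At i (Y t i) k) - (v - xs))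
      = ip n (X t l - xs) (X t l - xs)"
    unfolding ip_def by (intro sum.cong) (auto simp: X_sum algebra_simps)
  then show ?thesis using dual_obj_eq[of "Y t" "S t"] supp_fn_Y by (simp add: E_def)
qed

text \<open>Weak duality: each support function is tested at \<open>Av i xs\<close>. This also
  excludes the value minus infinity, so the sum is either infinite or a real number covered by
  \<open>dual_obj_eq\<close>.\<close>

lemma dual_obj_ge: "ereal opt_val \<le> dual_obj n l m A C v y"
proof -
  have ge: "ereal (ip (m i) (y i) (Av i xs)) \<le> supp_fn (m i) (C i) (y i)" if "i \<in> {1..l}" for i
    unfolding supp_fn_def using Av_xs[OF that] by (rule SUP_upper)
  show ?thesis
  proof (cases "\<exists>i\<in>{1..l}. supp_fn (m i) (C i) (y i) = \<infinity>")
    case True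
    then have "(\<Sum>i=1..l. supp_fn (m i) (C i) (y i)) = \<infinity>"
      by (subst sum_Pinfty) auto
    then show ?thesis by (simp add: dual_obj_def)
  next
    case False
    define s where "s i = real_of_ereal (supp_fn (m i) (C i) (y i))" for i
    have s: "supp_fn (m i) (C i) (y i) = ereal (s i)" if "i \<in> {1..l}" for i
      using that False ge[OF that] unfolding s_def by (cases "supp_fn (m i) (C i) (y i)") auto
    have "0 \<le> (\<Sum>i=1..l. s i - ip (m i) (y i) (Av i xs))"
      using ge s by (intro sum_nonneg) fastforce
    then show ?thesis using dual_obj_eq[of y s, OF s] by simp
  qed
qed

text \<open>Normality at \<open>Av i xs\<close> means that the support function is attained there,
  so both nonnegative parts of the gap vanish.\<close>

lemma dual_obj_dual_sol:
  assumes y: "y \<in> dual_sol"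
  shows "dual_obj n l m A C v y = ereal opt_val"
proof -
  have "supp_fn (m i) (C i) (y i) = ereal (ip (m i) (y i) (Av i xs))" if i: "i \<in> {1..l}" for i
    unfolding supp_fn_def using y i Av_xs[OF i]
    by (intro SUP_eqI) (auto simp: dual_sol_def ip_diff_right)
  moreover have "ip n ((\<lambda>k. \<Sum>i=1..l. At i (y i) k) - (v - xs)) ((\<lambda>k. \<Sum>i=1..l. At i (y i) k) - (v - xs)) = 0"
    using y unfolding ip_def by (intro sum.neutral) (auto simp: dual_sol_def)
  ultimately show ?thesis by (subst dual_obj_eq) auto
qed

lemma dual_opt_eq:
  assumes "y \<in> dual_sol" "y \<in> blocks l m"
  shows "dual_opt n l m A C v = ereal opt_val"
  unfolding dual_opt_def using assms dual_obj_dual_sol dual_obj_ge by (intro INF_eqI) fastforce+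

text \<open>Steps of \<open>Y\<close> are bounded by the square root of the gap, hence
  geometrically, so \<open>Y\<close> converges coordinatewise. The iterates satisfy the conditions
  of \<open>dual_sol\<close> up to errors that vanish with \<open>E\<close>, so the limit satisfies
  them exactly.\<close>

theorem linear_convergence:
  "\<exists>ys\<in>dual_argmin n l m A C v. \<exists>r a0 a1 :: real.
     0 < r \<and> r < 1 \<and> 0 < a0 \<and> a0 < 1 \<and> 0 < a1 \<and>
     (\<forall>t. vnorm n (X t l - xs) \<le> a1 * a0 ^ t \<and>
        dual_obj n l m A C v (Y (Suc t)) - dual_opt n l m A C v
          \<le> ereal r * (dual_obj n l m A C v (Y t) - dual_opt n l m A C v) \<and>
        bnorm l m (\<lambda>i. Y t i - ys i) \<le> a1 * a0 ^ t)"
proof -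
  obtain r where r: "0 < r" "r < 1" "\<And>t. E (Suc t) \<le> r * E t" using linear_rate by blast
  \<comment> \<open>Distances are controlled by the square root of the gap, so their rate is the
    square root of \<open>r\<close>.\<close>
  define a0 where "a0 = sqrt r"
  have a0: "0 < a0" "a0 < 1" using r by (auto simp: a0_def)
  have "E t \<le> r ^ t * E 0" for t
  proof (induction t)
    case (Suc t)
    have "E (Suc t) \<le> r * E t" by (rule r(3))
    also have "\<dots> \<le> r * (r ^ t * E 0)" using Suc r(1) by simp
    finally show ?case by (simp add: mult.assoc)
  qed simp
  then have sqrt_E: "sqrt (E t) \<le> sqrt (E 0) * a0 ^ t" for t
    unfolding a0_def by (metis mult.commute real_sqrt_le_mono real_sqrt_mult real_sqrt_power)
  have x_rate: "vnorm n (X t l - xs) \<le> sqrt 2 * sqrt (E 0) * a0 ^ t" for t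
  proof -
    have "vnorm n (X t l - xs) \<le> sqrt (2 * E t)"
      unfolding vnorm_def using half_dist_le_E[of t] by (intro real_sqrt_le_mono) simp
    also have "\<dots> \<le> sqrt 2 * (sqrt (E 0) * a0 ^ t)"
      using sqrt_E by (simp add: real_sqrt_mult)
    finally show ?thesis by (simp add: mult.assoc)
  qed
  define h where "h i = sqrt (2 / \<gamma> i) * sqrt (E 0)" for i
  have "\<exists>L. (\<lambda>t. Y t i k) \<longlonglongrightarrow> L \<and> (\<forall>t. \<bar>Y t i k - L\<bar> \<le> h i / (1 - a0) * a0 ^ t)"
    if i: "i \<in> {1..l}" and k: "k < m i" for i k
  proof (rule geometric_steps_converge[OF a0])
    fix t
    have "\<bar>Y (Suc t) i k - Y t i k\<bar> \<le> vnorm (m i) (D t i)"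
      using coordinate_le_vnorm[OF k, of "D t i"] by (simp add: D_def)
    also have "\<dots> \<le> sqrt (2 / \<gamma> i) * sqrt (E t - E (Suc t))" by (rule D_bound[OF i])
    also have "\<dots> \<le> sqrt (2 / \<gamma> i) * (sqrt (E 0) * a0 ^ t)"
    proof (rule mult_left_mono)
      have "sqrt (E t - E (Suc t)) \<le> sqrt (E t)" using E_nonneg[of "Suc t"] by simp
      then show "sqrt (E t - E (Suc t)) \<le> sqrt (E 0) * a0 ^ t" using sqrt_E[of t] by linarith
    qed (use gamma_pos[OF i] in simp)
    finally show "\<bar>Y (Suc t) i k - Y t i k\<bar> \<le> h i * a0 ^ t" by (simp add: h_def)
  qed
  then obtain L where L: "\<And>i k. i \<in> {1..l} \<Longrightarrow> k < m i \<Longrightarrow> (\<lambda>t. Y t i k) \<longlonglongrightarrow> L i k"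
    "\<And>i k t. i \<in> {1..l} \<Longrightarrow> k < m i \<Longrightarrow> \<bar>Y t i k - L i k\<bar> \<le> h i / (1 - a0) * a0 ^ t"
    by metis
  \<comment> \<open>Zero beyond \<open>m i\<close>, so that the limit belongs to
    \<open>blocks l m\<close>.\<close>
  define ys where "ys i k = (if k < m i then L i k else 0)" for i k
  have lim: "(\<lambda>t. Y t i k) \<longlonglongrightarrow> ys i k" if "i \<in> {1..l}" "k < m i" for i k
    using L(1)[OF that] that by (simp add: ys_def)
  have a0_lim: "(\<lambda>t. c * a0 ^ t) \<longlonglongrightarrow> 0" for c
    using tendsto_mult_right_zero[OF LIMSEQ_power_zero[of a0]] a0 by simp
  have E_lim: "E \<longlonglongrightarrow> 0"
  proof (rule tendsto_sandwich[OF _ _ tendsto_const])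
    have "E t \<le> E 0 * a0 ^ t" for t
    proof -
      have "E t = sqrt (E t) * sqrt (E t)" using E_nonneg by simp
      also have "\<dots> \<le> sqrt (E 0) * (sqrt (E 0) * a0 ^ t)"
        using sqrt_E E_le_E0 E_nonneg by (intro mult_mono) auto
      also have "\<dots> = E 0 * a0 ^ t" using E_nonneg[of 0] by (simp flip: mult.assoc)
      finally show ?thesis .
    qed
    then show "\<forall>\<^sub>F t in sequentially. E t \<le> E 0 * a0 ^ t" by simp
  qed (use E_nonneg a0_lim in auto)
  have "ys \<in> blocks l m" by (simp add: blocks_def vecs_def ys_def)
  moreover have sol: "ys \<in> dual_sol"
  proof -
    have "(\<Sum>i=1..l. At i (ys i) k) = v k - xs k" if k: "k < n" for k
    proof -
      have "(\<lambda>t. \<Sum>i=1..l. At i (Y t i) k) \<longlonglongrightarrow> (\<Sum>i=1..l. At i (ys i) k)"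
        using k unfolding mtv_def by (auto intro!: tendsto_intros lim)
      moreover have "(\<lambda>t. (X t l - xs) k) \<longlonglongrightarrow> 0"
      proof (rule Lim_null_comparison[OF _ a0_lim])
        show "\<forall>\<^sub>F t in sequentially. norm ((X t l - xs) k) \<le> sqrt 2 * sqrt (E 0) * a0 ^ t"
          using order_trans[OF coordinate_le_vnorm[OF k] x_rate] by simp
      qed
      then have "(\<lambda>t. (v k - xs k) - (X t l - xs) k) \<longlonglongrightarrow> (v k - xs k) - 0"
        by (intro tendsto_intros)
      moreover have "(v k - xs k) - (X t l - xs) k = (\<Sum>i=1..l. At i (Y t i) k)" for t
        by (simp add: X_sum)
      ultimately show ?thesis using LIMSEQ_unique by auto
    qed
    moreover have "ip (m i) (ys i) (u - Av i xs) \<le> 0" if i: "i \<in> {1..l}" and u: "u \<in> C i" for i u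
    proof (rule LIMSEQ_le[OF _ E_lim])
      show "(\<lambda>t. ip (m i) (Y t i) (u - Av i xs)) \<longlonglongrightarrow> ip (m i) (ys i) (u - Av i xs)"
        unfolding ip_def using i by (intro tendsto_intros lim) auto
      have "ip (m i) (Y t i) (u - Av i xs) \<le> E t" for t
        using S_ge[OF i u, of t] S_gap_le_E[OF i, of t] by (simp add: ip_diff_right)
      then show "\<exists>N. \<forall>t\<ge>N. ip (m i) (Y t i) (u - Av i xs) \<le> E t" by blast
    qed
    ultimately show ?thesis by (simp add: dual_sol_def)
  qed
  ultimately have opt: "dual_opt n l m A C v = ereal opt_val" "ys \<in> dual_argmin n l m A C v"
    using dual_opt_eq dual_obj_dual_sol by (auto simp: dual_argmin_def)
  define c where "c = (\<Sum>i=1..l. \<Sum>k<m i. h i / (1 - a0))"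
  have y_rate: "bnorm l m (\<lambda>i. Y t i - ys i) \<le> c * a0 ^ t" for t
  proof -
    have "bnorm l m (\<lambda>i. Y t i - ys i) \<le> (\<Sum>i=1..l. vnorm (m i) (Y t i - ys i))"
      unfolding bnorm_def L2_set_def[symmetric] by (intro L2_set_le_sum) simp
    also have "\<dots> \<le> (\<Sum>i=1..l. \<Sum>k<m i. \<bar>(Y t i - ys i) k\<bar>)"
      by (intro sum_mono vnorm_le_sum_abs)
    also have "\<dots> \<le> (\<Sum>i=1..l. \<Sum>k<m i. h i / (1 - a0) * a0 ^ t)"
      using L(2) by (intro sum_mono) (auto simp: ys_def)
    finally show ?thesis unfolding c_def sum_distrib_right .
  qed
  \<comment> \<open>One constant for both sequences; the summand 1 keeps it positive even when the
    initial gap is 0.\<close>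
  define a1 where "a1 = \<bar>c\<bar> + sqrt 2 * sqrt (E 0) + 1"
  have E0: "0 \<le> sqrt 2 * sqrt (E 0)" using E_nonneg by simp
  have a1: "0 < a1" "c \<le> a1" "sqrt 2 * sqrt (E 0) \<le> a1" using E0 unfolding a1_def by linarith+
  have "vnorm n (X t l - xs) \<le> a1 * a0 ^ t" for t
    by (rule order_trans[OF x_rate mult_right_mono[OF a1(3)]]) (use a0 in simp)
  moreover have "bnorm l m (\<lambda>i. Y t i - ys i) \<le> a1 * a0 ^ t" for t
    by (rule order_trans[OF y_rate mult_right_mono[OF a1(2)]]) (use a0 in simp)
  moreover have "dual_obj n l m A C v (Y (Suc t)) - dual_opt n l m A C v
      \<le> ereal r * (dual_obj n l m A C v (Y t) - dual_opt n l m A C v)" for t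
    using r(3)[of t] by (simp add: dual_obj_Y opt(1))
  ultimately show ?thesis using opt(2) r(1,2) a0 a1(1) by blast
qed

end

theorem theorem5p1:
  fixes n l :: nat and m :: "nat \<Rightarrow> nat"
    and A :: "nat \<Rightarrow> nat \<Rightarrow> nat \<Rightarrow> real"
    and C :: "nat \<Rightarrow> (nat \<Rightarrow> real) set"
    and v xs :: "nat \<Rightarrow> real"
    and \<gamma> :: "nat \<Rightarrow> real"
    and X :: "nat \<Rightarrow> nat \<Rightarrow> nat \<Rightarrow> real"
    and Y :: "nat \<Rightarrow> nat \<Rightarrow> nat \<Rightarrow> real"
  assumes l: "l \<ge> 1" and n: "n \<ge> 1"
    and m: "\<forall>i\<in>{1..l}. m i \<ge> 1"
    and C_poly: "\<forall>i\<in>{1..l}. polyhedral (m i) (C i) \<and> C i \<noteq> {}"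
    and A_nz: "\<forall>i\<in>{1..l}. \<exists>j<m i. \<exists>k<n. A i j k \<noteq> 0"
    and v: "v \<in> vecs n"
    and feas: "feasible n l m A C \<noteq> {}"
    and xs: "xs \<in> feasible n l m A C"
    and xs_opt: "\<forall>x\<in>feasible n l m A C. vnorm n (xs - v) \<le> vnorm n (x - v)"
    and gamma: "\<forall>i\<in>{1..l}. \<gamma> i = lambda_max n (\<lambda>x. mtv (A i) (m i) n (mv (A i) (m i) n x))"
    and Y0: "\<forall>i\<in>{1..l}. Y 0 i = (\<lambda>_. 0)"
    and X0: "X 0 l = v"
    and Xstart: "\<forall>t. X (Suc t) 0 = X t l"
    and Xstep: "\<forall>t. \<forall>i\<in>{1..l}. X (Suc t) i =
        (\<lambda>k. X (Suc t) (i - 1) k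
              - (1 / \<gamma> i) * mtv (A i) (m i) n (mv (A i) (m i) n (X (Suc t) (i - 1))) k
              + (1 / \<gamma> i) * mtv (A i) (m i) n
                  (proj (m i) (C i) (\<lambda>j. \<gamma> i * Y t i j + mv (A i) (m i) n (X (Suc t) (i - 1)) j)) k)"
    and Ystep: "\<forall>t. \<forall>i\<in>{1..l}. Y (Suc t) i =
        (\<lambda>j. Y t i j + (1 / \<gamma> i) * mv (A i) (m i) n (X (Suc t) (i - 1)) j
              - (1 / \<gamma> i) * proj (m i) (C i) (\<lambda>j'. \<gamma> i * Y t i j' + mv (A i) (m i) n (X (Suc t) (i - 1)) j') j)"
  shows "dual_argmin n l m A C v \<noteq> {} \<and>
    (\<exists>ys\<in>dual_argmin n l m A C v. \<exists>r a0 a1 :: real. \<exists>tb :: nat.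
       0 < r \<and> r < 1 \<and> 0 < a0 \<and> a0 < 1 \<and> 0 < a1 \<and> 0 < tb \<and>
       (\<forall>t\<ge>tb.
          vnorm n (X t l - xs) \<le> a1 * a0 ^ t \<and>
          dual_obj n l m A C v (Y (Suc t)) - dual_opt n l m A C v
            \<le> ereal r * (dual_obj n l m A C v (Y t) - dual_opt n l m A C v) \<and>
          bnorm l m (\<lambda>i. Y t i - ys i) \<le> a1 * a0 ^ t))"
proof -
  \<comment> \<open>The number of constraints, their normals and their bounds are packed into one
    triple, so that a single choice fixes them for all blocks.\<close>
  have "\<exists>q :: nat \<times> _. C i = polyset (m i) {..<fst q} (fst (snd q)) (snd (snd q))" if "i \<in> {1..l}" for i
  proof -
    have "polyhedral (m i) (C i)" using C_poly that by blast
    then obtain p :: nat and a b where "C i = polyset (m i) {..<p} a b"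
      by (auto simp: polyhedral_def polyset_def Ball_def)
    then show ?thesis by (intro exI[of _ "(p, a, b)"]) simp
  qed
  then have "\<forall>i\<in>{1..l}. \<exists>q :: nat \<times> _. C i = polyset (m i) {..<fst q} (fst (snd q)) (snd (snd q))" by blast
  from bchoice[OF this] obtain q :: "nat \<Rightarrow> nat \<times> _" where
    q: "\<forall>i\<in>{1..l}. C i = polyset (m i) {..<fst (q i)} (fst (snd (q i))) (snd (snd (q i)))" ..
  interpret block_iteration n l m "\<lambda>i. fst (q i)" A "\<lambda>i. fst (snd (q i))" "\<lambda>i. snd (snd (q i))" C v xs \<gamma> X Y
    by unfold_locales (use q A_nz xs xs_opt gamma Y0 X0 Xstart Xstep Ystep in blast)+
  obtain ys r a0 a1 where ys: "ys \<in> dual_argmin n l m A C v" "0 < r" "r < 1" "0 < a0" "a0 < 1" "0 < a1"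
    "\<forall>t. vnorm n (X t l - xs) \<le> a1 * a0 ^ t \<and>
        dual_obj n l m A C v (Y (Suc t)) - dual_opt n l m A C v
          \<le> ereal r * (dual_obj n l m A C v (Y t) - dual_opt n l m A C v) \<and>
        bnorm l m (\<lambda>i. Y t i - ys i) \<le> a1 * a0 ^ t"
    using linear_convergence by blast
  show ?thesis
  proof (rule conjI)
    show "dual_argmin n l m A C v \<noteq> {}" using ys(1) by blast
  \<comment> \<open>The estimates hold from the first iterate on, so the threshold can be the least
    positive integer.\<close>
  qed (rule bexI[OF _ ys(1)], rule exI[of _ r], rule exI[of _ a0], rule exI[of _ a1], rule exI[of _ 1],
      use ys in auto)
qed

end
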